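(* Let $\tau=1.25506$, $\rho=\tfrac12\log_2(3/2)$, $\epsilon=5+\tfrac32\log_2(3/2)$, $\gamma=\rho\,\tau\log_2(e)$ and $\kappa=\epsilon-5$ (so $\gamma\approx 0.53$ and $\kappa\approx 0.88$). Let $d\ge 2$. Then every simplicial $d$-cone $C=\mathbb{R}_+v_1+\cdots+\mathbb{R}_+v_d\subset\mathbb{R}^d$ which is not already unimodular (i.e., $\mu(C)>1$) has a unimodular triangulation $C=D_1\cup\ldots\cup D_t$ such that for all $i$ $$\operatorname{Hilb}(D_i)\subset\left(\frac d4\cdot\mu(C)^{\gamma d+2\log_2(d)+\kappa}\right)\Delta_C .$$
   Context: A simplicial $d$-cone $C=\mathbb{R}_+v_1+\cdots+\mathbb{R}_+v_d\subset\mathbb{R}^d$ is generated by linearly independent primitive vectors $v_1,\dots,v_d\in\mathbb{Z}^d$ (its extreme integral generators). Its multiplicity $\mu(C)$ is the index in $\mathbb{Z}^d$ of the sublattice spanned by $v_1,\dots,v_d$; $C$ is unimodular if $\mu(C)=1$. The basic simplex $\Delta_C$ is the convex hull of $0,v_1,\dots,v_d$, and $c\Delta_C=\{cy: y\in\Delta_C\}$ for $c\ge 0$. A triangulation $C=D_1\cup\ldots\cup D_t$ is a decomposition of $C$ into finitely many simplicial $d$-cones $D_i$ generated by vectors in $\mathbb{Z}^d$, any two of which intersect in a common face; it is unimodular if all $D_i$ are unimodular. $\operatorname{Hilb}(D)$ is the Hilbert basis of $D$, i.e. the unique minimal generating set of the monoid $D\cap\mathbb{Z}^d$ (for unimodular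 $D$ it is the set of the $d$ primitive generators of $D$). *)

theory Defs
  imports "HOL-Analysis.Analysis"
begin

text \<open>The dimension \<open>d\<close> is \<open>CARD('n)\<close>; a simplicial cone is presented by the family
  \<open>v :: 'n \<Rightarrow> real ^ 'n\<close> of its \<open>d\<close> extreme integral generators, which the cone determines
  up to reindexing.\<close>

definition int_lattice :: "(real ^ 'n) set" where
  "int_lattice = {x. \<forall>i. x $ i \<in> \<int>}"

definition primitive :: "real ^ 'n \<Rightarrow> bool" where
  "primitive x \<longleftrightarrow> x \<in> int_lattice \<and> x \<noteq> 0 \<and>
     (\<forall>k::nat. \<forall>y\<in>int_lattice. x = of_nat k *\<^sub>R y \<longrightarrow> k = 1)"

definition simplicial_generators :: "('n::finite \<Rightarrow> real ^ 'n) \<Rightarrow> bool" where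
  "simplicial_generators v \<longleftrightarrow> (\<forall>i. primitive (v i)) \<and> inj v \<and> independent (range v)"

definition cone_of :: "('n::finite \<Rightarrow> real ^ 'n) \<Rightarrow> (real ^ 'n) set" where
  "cone_of v = {\<Sum>i\<in>UNIV. a i *\<^sub>R v i | a. \<forall>i. 0 \<le> a i}"

definition simplicial_cone :: "(real ^ 'n::finite) set \<Rightarrow> bool" where
  "simplicial_cone C \<longleftrightarrow> (\<exists>v. simplicial_generators v \<and> C = cone_of v)"

definition sublattice :: "('n::finite \<Rightarrow> real ^ 'n) \<Rightarrow> (real ^ 'n) set" where
  "sublattice v = {\<Sum>i\<in>UNIV. of_int (a i) *\<^sub>R v i | a :: 'n \<Rightarrow> int. True}"

text \<open>The index of the sublattice: the number of its cosets in the integer lattice. It is finite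
  and positive whenever \<open>v\<close> satisfies \<open>simplicial_generators\<close>.\<close>

definition multiplicity_of :: "('n::finite \<Rightarrow> real ^ 'n) \<Rightarrow> nat" where
  "multiplicity_of v = card (int_lattice //
     {(x, y). x \<in> int_lattice \<and> y \<in> int_lattice \<and> x - y \<in> sublattice v})"

definition unimodular_cone :: "(real ^ 'n::finite) set \<Rightarrow> bool" where
  "unimodular_cone D \<longleftrightarrow>
     (\<exists>w. simplicial_generators w \<and> D = cone_of w \<and> multiplicity_of w = 1)"

definition basic_simplex :: "('n::finite \<Rightarrow> real ^ 'n) \<Rightarrow> (real ^ 'n) set" where
  "basic_simplex v = convex hull (insert 0 (range v))"

definition triangulation :: "(real ^ 'n::finite) set \<Rightarrow> (real ^ 'n) set set \<Rightarrow> bool" where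
  "triangulation C T \<longleftrightarrow> finite T \<and> (\<forall>D\<in>T. simplicial_cone D) \<and> \<Union>T = C \<and>
     (\<forall>D\<in>T. \<forall>E\<in>T. (D \<inter> E) face_of D \<and> (D \<inter> E) face_of E)"

definition unimodular_triangulation :: "(real ^ 'n::finite) set \<Rightarrow> (real ^ 'n) set set \<Rightarrow> bool" where
  "unimodular_triangulation C T \<longleftrightarrow> triangulation C T \<and> (\<forall>D\<in>T. unimodular_cone D)"

definition add_submonoid :: "'a::comm_monoid_add set \<Rightarrow> bool" where
  "add_submonoid M \<longleftrightarrow> 0 \<in> M \<and> (\<forall>x\<in>M. \<forall>y\<in>M. x + y \<in> M)"

definition minimal_generating_set :: "'a::comm_monoid_add set \<Rightarrow> 'a set \<Rightarrow> bool" where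
  "minimal_generating_set M G \<longleftrightarrow>
     add_submonoid hull G = M \<and> (\<forall>G'. G' \<subset> G \<longrightarrow> add_submonoid hull G' \<noteq> M)"

definition Hilb :: "(real ^ 'n) set \<Rightarrow> (real ^ 'n) set" where
  "Hilb D = (THE G. minimal_generating_set (D \<inter> int_lattice) G)"

definition tau :: real where "tau = 1.25506"
definition rho :: real where "rho = 1/2 * log 2 (3/2)"
definition eps :: real where "eps = 5 + 3/2 * log 2 (3/2)"
definition gam :: real where "gam = rho * tau * log 2 (exp 1)"
definition kappa :: real where "kappa = eps - 5"

end

theory Submission
  imports Defs
begin

text \<open>Stellar subdivision of a fan at a lattice point \<open>x = \<Sum> (r\<^sub>i / p) w\<^sub>i\<close> with \<open>p\<close> prime and
  \<open>0 \<le> r\<^sub>i < p\<close> replaces the multiplicity \<open>\<mu>\<close> of a cone by the numbers \<open>r\<^sub>i \<mu> / p\<close> and at most doubles the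
  sum of the heights of its generators. The cost of a chain of subdivisions is controlled by the
  completely additive potential with \<open>F 2 = 1\<close> and \<open>F q = A log q\<close> for odd primes \<open>q\<close>, which must
  drop by 1 in every step. A residue \<open>r\<close> violates this only if it is odd and close to \<open>p\<close>; if \<open>A\<close> is
  at least \<open>25 d / 48\<close>, there are fewer than \<open>(p - 1) / d\<close> such residues, so by counting some multiple of a
  given class of order \<open>p\<close> avoids them in all \<open>d\<close> coordinates. Hence the generators of the final
  unimodular cones have height at most \<open>d 2\<^sup>F\<close>, which is at most \<open>d \<mu>\<^sup>A\<close>.\<close>

section \<open>Simplicial cones and stellar subdivision\<close>

text \<open>With the plain potential \<open>A * log 2 n\<close>, all residues in a window of
  relative length about ln 2 / A below p would be bad, and avoiding them in d coordinates would need
  A near d ln 2, about 0.69 d, more than gamma d. Giving the prime 2 the weight 1 instead of A makes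
  even residues harmless once A \<ge> 2 and so halves the number of bad ones; p = 2 itself still
  works because its only nonzero residue is 1. A second obstacle: subdividing at x changes every
  cone that contains the face of x, not only the cone for which x was found. All these cones express
  x by the same coefficients on the same rays, so the drop of the potential depends only on the
  exchanged ray. Thus (sum of heights) * 2^F never increases along a subdivision, and at index 1 it
  is the sum of heights. Height means the linear form with value 1 on each generator of C. In the
  end A is the claimed exponent minus 3/2; the surplus 3/2 pays for the factor 1/4.\<close>

definition pos_span :: "'a::real_vector set \<Rightarrow> 'a set" where
  "pos_span S = {\<Sum>s\<in>S. a s *\<^sub>R s | a. \<forall>s\<in>S. 0 \<le> a s}"

lemma pos_spanI: "(\<And>s. s \<in> S \<Longrightarrow> 0 \<le> a s) \<Longrightarrow> y = (\<Sum>s\<in>S. a s *\<^sub>R s) \<Longrightarrow> y \<in> pos_span S"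
  unfolding pos_span_def by auto

lemma pos_spanE:
  assumes "y \<in> pos_span S"
  obtains a where "\<forall>s\<in>S. 0 \<le> a s" "y = (\<Sum>s\<in>S. a s *\<^sub>R s)"
  using assms unfolding pos_span_def by auto

text \<open>Sets of rays, unlike indexed families, can be intersected: common faces become spans of
  common generators.\<close>

lemma cone_of_eq_pos_span:
  assumes "inj w"
  shows "cone_of w = pos_span (range w)"
proof (intro set_eqI iffI)
  fix y assume "y \<in> cone_of w"
  then obtain a where a: "\<forall>i. 0 \<le> a i" "y = (\<Sum>i\<in>UNIV. a i *\<^sub>R w i)"
    unfolding cone_of_def by auto
  have "y = (\<Sum>s\<in>range w. a (inv w s) *\<^sub>R s)"
    unfolding a(2) by (subst sum.reindex[OF assms]) (simp add: assms)
  then show "y \<in> pos_span (range w)" using a(1) by (auto intro: pos_spanI)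
next
  fix y assume "y \<in> pos_span (range w)"
  then obtain a where a: "\<forall>s\<in>range w. 0 \<le> a s" "y = (\<Sum>s\<in>range w. a s *\<^sub>R s)"
    by (rule pos_spanE)
  have "y = (\<Sum>i\<in>UNIV. a (w i) *\<^sub>R w i)"
    unfolding a(2) by (subst sum.reindex[OF assms]) simp
  then show "y \<in> cone_of w" using a(1) unfolding cone_of_def by auto
qed

lemma pos_span_mono:
  assumes "S \<subseteq> S'" "finite S'"
  shows "pos_span S \<subseteq> pos_span S'"
proof
  fix y assume "y \<in> pos_span S"
  then obtain a where a: "\<forall>s\<in>S. 0 \<le> a s" "y = (\<Sum>s\<in>S. a s *\<^sub>R s)" by (rule pos_spanE)
  have "y = (\<Sum>s\<in>S'. (if s \<in> S then a s else 0) *\<^sub>R s)"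
    unfolding a(2) by (rule sum.mono_neutral_cong_left) (use assms in auto)
  then show "y \<in> pos_span S'" using a(1) by (intro pos_spanI) auto
qed

lemma pos_span_add:
  assumes "x \<in> pos_span S" "y \<in> pos_span S"
  shows "x + y \<in> pos_span S"
proof -
  from assms(1) obtain a where a: "\<forall>s\<in>S. 0 \<le> a s" "x = (\<Sum>s\<in>S. a s *\<^sub>R s)" by (rule pos_spanE)
  from assms(2) obtain b where b: "\<forall>s\<in>S. 0 \<le> b s" "y = (\<Sum>s\<in>S. b s *\<^sub>R s)" by (rule pos_spanE)
  show ?thesis
    by (rule pos_spanI[where a = "\<lambda>s. a s + b s"])
      (use a b in \<open>auto simp: scaleR_add_left sum.distrib\<close>)
qed

lemma pos_span_scale:
  assumes "x \<in> pos_span S" "0 \<le> t"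
  shows "t *\<^sub>R x \<in> pos_span S"
proof -
  from assms(1) obtain a where a: "\<forall>s\<in>S. 0 \<le> a s" "x = (\<Sum>s\<in>S. a s *\<^sub>R s)" by (rule pos_spanE)
  show ?thesis
    by (rule pos_spanI[where a = "\<lambda>s. t * a s"])
      (use a assms(2) in \<open>auto simp: scaleR_sum_right\<close>)
qed

lemma convex_pos_span: "convex (pos_span S)"
  unfolding convex_def using pos_span_add pos_span_scale by blast

lemma independent_sum_eqD:
  assumes "independent S" "finite S" "(\<Sum>s\<in>S. a s *\<^sub>R s) = (\<Sum>s\<in>S. b s *\<^sub>R s)" "s \<in> S"
  shows "a s = b s"
proof -
  have "(\<Sum>s\<in>S. (a s - b s) *\<^sub>R s) = 0"
    using assms(3) by (simp add: scaleR_diff_left sum_subtractf)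
  from independentD[OF assms(1,2) subset_refl this assms(4)] show ?thesis by simp
qed

lemma mem_pos_span_subset_zero:
  assumes "independent S" "finite S" "R \<subseteq> S" "(\<Sum>s\<in>S. a s *\<^sub>R s) \<in> pos_span R" "s \<in> S" "s \<notin> R"
  shows "a s = 0"
proof -
  from assms(4) obtain b where b: "(\<Sum>s\<in>S. a s *\<^sub>R s) = (\<Sum>s\<in>R. b s *\<^sub>R s)" by (rule pos_spanE)
  also have "\<dots> = (\<Sum>s\<in>S. (if s \<in> R then b s else 0) *\<^sub>R s)"
    by (rule sum.mono_neutral_cong_left) (use assms in auto)
  finally have "a s = (if s \<in> R then b s else 0)" by (rule independent_sum_eqD[OF assms(1,2) _ assms(5)])
  then show ?thesis using assms(6) by simp
qed

text \<open>If a convex combination with positive weights has zero coordinates off \<open>R\<close>,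
  so have both endpoints, since their coordinates are nonnegative.\<close>

lemma pos_span_face_of:
  assumes "independent S" "finite S" "R \<subseteq> S"
  shows "pos_span R face_of pos_span S"
  unfolding face_of_def
proof (intro conjI ballI impI)
  show "pos_span R \<subseteq> pos_span S" using assms by (intro pos_span_mono)
  show "convex (pos_span R)" by (rule convex_pos_span)
  fix x y z assume xy: "x \<in> pos_span S" "y \<in> pos_span S" "z \<in> pos_span R" "z \<in> open_segment x y"
  from xy(1) obtain a where a: "\<forall>s\<in>S. 0 \<le> a s" "x = (\<Sum>s\<in>S. a s *\<^sub>R s)" by (rule pos_spanE)
  from xy(2) obtain b where b: "\<forall>s\<in>S. 0 \<le> b s" "y = (\<Sum>s\<in>S. b s *\<^sub>R s)" by (rule pos_spanE)
  from xy(4) obtain t where t: "0 < t" "t < 1" "z = (1 - t) *\<^sub>R x + t *\<^sub>R y"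
    by (auto simp: in_segment)
  have z: "z = (\<Sum>s\<in>S. ((1 - t) * a s + t * b s) *\<^sub>R s)"
    unfolding t(3) a(2) b(2) by (simp add: scaleR_add_left sum.distrib scaleR_sum_right)
  have "(\<Sum>s\<in>S. ((1 - t) * a s + t * b s) *\<^sub>R s) \<in> pos_span R" using xy(3) z by simp
  note zR = mem_pos_span_subset_zero[OF assms this]
  have zero: "a s = 0 \<and> b s = 0" if "s \<in> S" "s \<notin> R" for s
  proof -
    have "(1 - t) * a s + t * b s = 0"
      using zR that by blast
    moreover have "0 \<le> (1 - t) * a s" "0 \<le> t * b s" using t a(1) b(1) that by auto
    ultimately show ?thesis using t by (smt (verit) mult_eq_0_iff)
  qed
  have "x = (\<Sum>s\<in>R. a s *\<^sub>R s)"
    unfolding a(2) by (rule sum.mono_neutral_right) (use assms zero in auto)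
  moreover have "y = (\<Sum>s\<in>R. b s *\<^sub>R s)"
    unfolding b(2) by (rule sum.mono_neutral_right) (use assms zero in auto)
  ultimately show "x \<in> pos_span R" "y \<in> pos_span R"
    using a(1) b(1) assms(3) pos_spanI[of R a x] pos_spanI[of R b y] by auto
qed

section \<open>Stellar subdivision of a single cone and of pairs of cones\<close>

lemma pos_span_insert_ray:
  assumes "finite S" "u \<in> S"
  shows "y \<in> pos_span (insert x (S - {u})) \<longleftrightarrow>
    (\<exists>t b. 0 \<le> t \<and> (\<forall>s\<in>S. 0 \<le> b s) \<and> b u = 0 \<and> y = t *\<^sub>R x + (\<Sum>s\<in>S. b s *\<^sub>R s))"
proof
  assume "y \<in> pos_span (insert x (S - {u}))"
  then obtain a where a: "\<forall>s\<in>insert x (S - {u}). 0 \<le> a s"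
    "y = (\<Sum>s\<in>insert x (S - {u}). a s *\<^sub>R s)" by (rule pos_spanE)
  \<comment> \<open>\<open>x\<close> may already lie in \<open>S\<close>; its coefficient then moves
    into \<open>t\<close>. Summing over all of \<open>S\<close> with \<open>b u = 0\<close> keeps
    old and new coordinates on one index set.\<close>
  define b where "b = (\<lambda>s. if s = x \<or> s = u then 0 else a s)"
  have "y = a x *\<^sub>R x + (\<Sum>s\<in>S - {u} - {x}. a s *\<^sub>R s)"
    unfolding a(2) using assms by (subst sum.insert_remove) auto
  also have "(\<Sum>s\<in>S - {u} - {x}. a s *\<^sub>R s) = (\<Sum>s\<in>S. b s *\<^sub>R s)"
    by (rule sum.mono_neutral_cong_left) (use assms in \<open>auto simp: b_def\<close>)
  finally have "y = a x *\<^sub>R x + (\<Sum>s\<in>S. b s *\<^sub>R s)" .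
  moreover have "\<forall>s\<in>S. 0 \<le> b s" "b u = 0" using a(1) by (auto simp: b_def)
  ultimately show "\<exists>t b. 0 \<le> t \<and> (\<forall>s\<in>S. 0 \<le> b s) \<and> b u = 0 \<and> y = t *\<^sub>R x + (\<Sum>s\<in>S. b s *\<^sub>R s)"
    using a(1) by blast
next
  assume "\<exists>t b. 0 \<le> t \<and> (\<forall>s\<in>S. 0 \<le> b s) \<and> b u = 0 \<and> y = t *\<^sub>R x + (\<Sum>s\<in>S. b s *\<^sub>R s)"
  then obtain t b where tb: "0 \<le> t" "\<forall>s\<in>S. 0 \<le> b s" "b u = 0" "y = t *\<^sub>R x + (\<Sum>s\<in>S. b s *\<^sub>R s)"
    by blast
  have "x \<in> pos_span {x}" by (rule pos_spanI[where a = "\<lambda>_. 1"]) auto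
  then have "t *\<^sub>R x \<in> pos_span (insert x (S - {u}))"
    using pos_span_mono[of "{x}" "insert x (S - {u})"] assms tb(1) by (auto intro: pos_span_scale)
  moreover have "(\<Sum>s\<in>S. b s *\<^sub>R s) = (\<Sum>s\<in>S - {u}. b s *\<^sub>R s)"
    by (rule sum.mono_neutral_right) (use assms tb(3) in auto)
  then have "(\<Sum>s\<in>S. b s *\<^sub>R s) \<in> pos_span (S - {u})"
    using tb(2) by (intro pos_spanI[where a = b]) auto
  then have "(\<Sum>s\<in>S. b s *\<^sub>R s) \<in> pos_span (insert x (S - {u}))"
    using pos_span_mono[of "S - {u}" "insert x (S - {u})"] assms by auto
  ultimately show "y \<in> pos_span (insert x (S - {u}))" unfolding tb(4) by (rule pos_span_add)
qed

text \<open>Subtracting the largest multiple of \<open>x\<close> that keeps all coordinates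
  nonnegative kills the coordinate of some \<open>u\<close> in \<open>U\<close>.\<close>

lemma pos_span_stellar_Un:
  assumes "finite S" "U \<subseteq> S" "U \<noteq> {}" "\<And>s. s \<in> U \<Longrightarrow> 0 < c s" "x = (\<Sum>s\<in>U. c s *\<^sub>R s)"
  shows "pos_span S = (\<Union>u\<in>U. pos_span (insert x (S - {u})))"
proof (intro set_eqI iffI)
  have finU: "finite U" using assms finite_subset by blast
  define c' where "c' = (\<lambda>s. if s \<in> U then c s else 0)"
  have x: "x = (\<Sum>s\<in>S. c' s *\<^sub>R s)"
    unfolding assms(5) c'_def by (rule sum.mono_neutral_cong_left) (use assms in auto)
  have c'0: "0 \<le> c' s" for s using assms(4) by (auto simp: c'_def less_imp_le)
  {
    fix y assume "y \<in> pos_span S"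
    then obtain a where a: "\<forall>s\<in>S. 0 \<le> a s" "y = (\<Sum>s\<in>S. a s *\<^sub>R s)" by (rule pos_spanE)
    define u where "u = arg_min_on (\<lambda>s. a s / c s) U"
    have u: "u \<in> U" "\<And>s. s \<in> U \<Longrightarrow> a u / c u \<le> a s / c s"
      unfolding u_def
      by (rule arg_min_if_finite(1)[OF finU assms(3)], rule arg_min_least[OF finU assms(3)])
    define t where "t = a u / c u"
    have t: "0 \<le> t" using u(1) assms(2,4) a(1) unfolding t_def by (auto intro!: divide_nonneg_pos)
    define b where "b = (\<lambda>s. a s - t * c' s)"
    have "y = t *\<^sub>R x + (\<Sum>s\<in>S. b s *\<^sub>R s)"
      unfolding a(2) x b_def by (simp add: scaleR_diff_left sum_subtractf scaleR_sum_right)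
    moreover have "b u = 0" using u(1) assms(4)[of u] by (simp add: b_def t_def c'_def)
    moreover have "0 \<le> b s" if "s \<in> S" for s
      using u(2)[of s] assms(4)[of s] a(1) that by (auto simp: b_def t_def c'_def field_simps)
    ultimately have "y \<in> pos_span (insert x (S - {u}))"
      using t pos_span_insert_ray[of S u y x] assms(1,2) u(1) by blast
    then show "y \<in> (\<Union>u\<in>U. pos_span (insert x (S - {u})))" using u(1) by blast
  }
  {
    fix y assume "y \<in> (\<Union>u\<in>U. pos_span (insert x (S - {u})))"
    then obtain u where u: "u \<in> U" "y \<in> pos_span (insert x (S - {u}))" by blast
    then obtain t b where tb: "0 \<le> t" "\<forall>s\<in>S. 0 \<le> b s" "y = t *\<^sub>R x + (\<Sum>s\<in>S. b s *\<^sub>R s)"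
      using pos_span_insert_ray[of S u y x] assms(1,2) by blast
    have "x \<in> pos_span S" using c'0 x by (intro pos_spanI[of S c' x])
    moreover have "(\<Sum>s\<in>S. b s *\<^sub>R s) \<in> pos_span S" using tb(2) by (intro pos_spanI[of S b]) auto
    ultimately show "y \<in> pos_span S" unfolding tb(3)
      by (intro pos_span_add pos_span_scale tb(1))
  }
qed

text \<open>A point of a stellar cone determines its coefficient at the new ray: it is the minimum
  over \<open>U\<close> of the quotients of its old coordinates by those of \<open>x\<close>.\<close>

lemma pos_span_stellar_Int:
  assumes S: "finite S" "independent S" and S': "finite S'" "independent S'"
    and I: "pos_span S \<inter> pos_span S' \<subseteq> pos_span (S \<inter> S')"
    and U: "U \<subseteq> S" "U \<subseteq> S'" "\<And>s. s \<in> U \<Longrightarrow> 0 < c s" "x = (\<Sum>s\<in>U. c s *\<^sub>R s)"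
    and u: "u \<in> U" "u' \<in> U"
  shows "pos_span (insert x (S - {u})) \<inter> pos_span (insert x (S' - {u'}))
    \<subseteq> pos_span (insert x (S - {u}) \<inter> insert x (S' - {u'}))"
proof
  fix y assume y: "y \<in> pos_span (insert x (S - {u})) \<inter> pos_span (insert x (S' - {u'}))"
  define c' where "c' = (\<lambda>s. if s \<in> U then c s else 0)"
  have x: "x = (\<Sum>s\<in>S. c' s *\<^sub>R s)" "x = (\<Sum>s\<in>S'. c' s *\<^sub>R s)"
    unfolding U(4) c'_def using S(1) S'(1) U(1,2) by (auto intro!: sum.mono_neutral_cong_left)
  have c'0: "0 \<le> c' s" for s using U(3) by (auto simp: c'_def less_imp_le)
  obtain t b where tb: "0 \<le> t" "\<forall>s\<in>S. 0 \<le> b s" "b u = 0" "y = t *\<^sub>R x + (\<Sum>s\<in>S. b s *\<^sub>R s)"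
    using y pos_span_insert_ray[of S u y x] S(1) U(1) u by blast
  obtain t' b' where tb': "0 \<le> t'" "\<forall>s\<in>S'. 0 \<le> b' s" "b' u' = 0" "y = t' *\<^sub>R x + (\<Sum>s\<in>S'. b' s *\<^sub>R s)"
    using y pos_span_insert_ray[of S' u' y x] S'(1) U(2) u by blast
  define a where "a = (\<lambda>s. t * c' s + b s)"
  define a' where "a' = (\<lambda>s. t' * c' s + b' s)"
  have ya: "y = (\<Sum>s\<in>S. a s *\<^sub>R s)"
    unfolding tb(4) x(1) a_def by (simp add: scaleR_add_left sum.distrib scaleR_sum_right)
  have ya': "y = (\<Sum>s\<in>S'. a' s *\<^sub>R s)"
    unfolding tb'(4) x(2) a'_def by (simp add: scaleR_add_left sum.distrib scaleR_sum_right)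
  have "y \<in> pos_span S \<inter> pos_span S'"
    using tb(1,2) tb'(1,2) c'0 pos_spanI[of S a, OF _ ya] pos_spanI[of S' a', OF _ ya']
    by (auto simp: a_def a'_def)
  then have yI: "y \<in> pos_span (S \<inter> S')" using I by blast
  then obtain e where e: "y = (\<Sum>s\<in>S \<inter> S'. e s *\<^sub>R s)" by (rule pos_spanE)
  have a0: "a s = (if s \<in> S' then e s else 0)" if "s \<in> S" for s
  proof (rule independent_sum_eqD[OF S(2,1) _ that])
    show "(\<Sum>s\<in>S. a s *\<^sub>R s) = (\<Sum>s\<in>S. (if s \<in> S' then e s else 0) *\<^sub>R s)"
      unfolding ya[symmetric] e by (rule sum.mono_neutral_cong_left) (use S in auto)
  qed
  have a'0: "a' s = (if s \<in> S then e s else 0)" if "s \<in> S'" for s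
  proof (rule independent_sum_eqD[OF S'(2,1) _ that])
    show "(\<Sum>s\<in>S'. a' s *\<^sub>R s) = (\<Sum>s\<in>S'. (if s \<in> S then e s else 0) *\<^sub>R s)"
      unfolding ya'[symmetric] e by (rule sum.mono_neutral_cong_left) (use S' in auto)
  qed
  have eq: "a s = a' s" if "s \<in> S \<inter> S'" for s using a0 a'0 that by auto
  have uu: "u \<in> S" "u \<in> S'" "u' \<in> S" "u' \<in> S'" using u U by auto
  \<comment> \<open>At \<open>u\<close> the remainder \<open>b\<close> vanishes while
    \<open>b'\<close> is nonnegative, so t' \<le> t; the coordinate at \<open>u'\<close> gives the
    reverse inequality.\<close>
  have "t * c u = t' * c u + b' u"
    using eq[of u] tb(3) u uu by (simp add: a_def a'_def c'_def)
  then have 1: "t' * c u \<le> t * c u" using tb'(2) uu by simp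
  have "t' * c u' = t * c u' + b u'"
    using eq[of u'] tb'(3) u uu by (simp add: a_def a'_def c'_def)
  then have 2: "t * c u' \<le> t' * c u'" using tb(2) uu by simp
  have tt: "t = t'" using 1 2 U(3)[OF u(1)] U(3)[OF u(2)] by simp
  have bb: "b s = b' s" if "s \<in> S \<inter> S'" for s using eq[OF that] tt by (simp add: a_def a'_def)
  have b0: "b s = 0" if "s \<in> S" "s \<notin> S'" for s
    using a0[OF that(1)] that U(2) by (auto simp: a_def c'_def subset_iff split: if_splits)
  \<comment> \<open>\<open>b\<close> vanishes off \<open>S'\<close>, at \<open>u\<close> and,
    agreeing there with \<open>b'\<close>, also at \<open>u'\<close>.\<close>
  have "(\<Sum>s\<in>S. b s *\<^sub>R s) = (\<Sum>s\<in>(S - {u}) \<inter> (S' - {u'}). b s *\<^sub>R s)"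
    by (rule sum.mono_neutral_right) (use S b0 bb tb(3) tb'(3) uu in auto)
  then have "(\<Sum>s\<in>S. b s *\<^sub>R s) \<in> pos_span ((S - {u}) \<inter> (S' - {u'}))"
    using tb(2) by (intro pos_spanI[where a = b]) auto
  then have 3: "(\<Sum>s\<in>S. b s *\<^sub>R s) \<in> pos_span (insert x (S - {u}) \<inter> insert x (S' - {u'}))"
    using pos_span_mono[of "(S - {u}) \<inter> (S' - {u'})" "insert x (S - {u}) \<inter> insert x (S' - {u'})"]
      S(1) S'(1) by blast
  have "x \<in> pos_span {x}" by (rule pos_spanI[where a = "\<lambda>_. 1"]) auto
  then have "t *\<^sub>R x \<in> pos_span (insert x (S - {u}) \<inter> insert x (S' - {u'}))"
    using pos_span_mono[of "{x}" "insert x (S - {u}) \<inter> insert x (S' - {u'})"] S(1) S'(1) tb(1)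
    by (auto intro: pos_span_scale)
  with 3 show "y \<in> pos_span (insert x (S - {u}) \<inter> insert x (S' - {u'}))"
    unfolding tb(4) using pos_span_add by blast
qed

text \<open>Some ray of \<open>U\<close> is missing from \<open>S'\<close>. Points of the common
  face have coordinate zero there, which a positive multiple of \<open>x\<close> would spoil; so
  \<open>x\<close> contributes nothing.\<close>

lemma pos_span_stellar_Int_unchanged:
  assumes S: "finite S" "independent S" and S': "finite S'"
    and I: "pos_span S \<inter> pos_span S' \<subseteq> pos_span (S \<inter> S')"
    and U: "U \<subseteq> S" "\<not> U \<subseteq> S'" "\<And>s. s \<in> U \<Longrightarrow> 0 < c s" "x = (\<Sum>s\<in>U. c s *\<^sub>R s)"
    and u: "u \<in> U"
  shows "pos_span (insert x (S - {u})) \<inter> pos_span S' \<subseteq> pos_span (insert x (S - {u}) \<inter> S')"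
proof
  fix y assume y: "y \<in> pos_span (insert x (S - {u})) \<inter> pos_span S'"
  define c' where "c' = (\<lambda>s. if s \<in> U then c s else 0)"
  have x: "x = (\<Sum>s\<in>S. c' s *\<^sub>R s)"
    unfolding U(4) c'_def using S(1) U(1,2) by (auto intro!: sum.mono_neutral_cong_left)
  have c'0: "0 \<le> c' s" for s using U(3) by (auto simp: c'_def less_imp_le)
  obtain t b where tb: "0 \<le> t" "\<forall>s\<in>S. 0 \<le> b s" "b u = 0" "y = t *\<^sub>R x + (\<Sum>s\<in>S. b s *\<^sub>R s)"
    using y pos_span_insert_ray[of S u y x] S(1) U(1) u by blast
  define a where "a = (\<lambda>s. t * c' s + b s)"
  have ya: "y = (\<Sum>s\<in>S. a s *\<^sub>R s)"
    unfolding tb(4) x(1) a_def by (simp add: scaleR_add_left sum.distrib scaleR_sum_right)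
  have "y \<in> pos_span S" using tb(1,2) c'0 pos_spanI[of S a, OF _ ya] by (auto simp: a_def)
  then have yI: "y \<in> pos_span (S \<inter> S')" using I y by blast
  have a0: "a s = 0" if "s \<in> S" "s \<notin> S'" for s
    using mem_pos_span_subset_zero[OF S(2,1), of "S \<inter> S'" a s] yI ya that by auto
  obtain u0 where u0: "u0 \<in> U" "u0 \<notin> S'" using U(2) by blast
  have "t * c u0 + b u0 = 0" using a0[of u0] u0 U(1) by (auto simp: a_def c'_def)
  moreover have "0 \<le> b u0" "0 < c u0" using u0 tb(2) U(1,3) by auto
  ultimately have t0: "t = 0" using tb(1) by (smt (verit) mult_pos_pos)
  have "y = (\<Sum>s\<in>S. b s *\<^sub>R s)" using tb(4) t0 by simp
  also have "\<dots> = (\<Sum>s\<in>(S - {u}) \<inter> S'. b s *\<^sub>R s)"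
    by (rule sum.mono_neutral_right) (use S a0 t0 tb(3) in \<open>auto simp: a_def\<close>)
  finally have "y \<in> pos_span ((S - {u}) \<inter> S')"
    using tb(2) by (intro pos_spanI[where a = b]) auto
  then show "y \<in> pos_span (insert x (S - {u}) \<inter> S')"
    using pos_span_mono[of "(S - {u}) \<inter> S'" "insert x (S - {u}) \<inter> S'"] S' by blast
qed

section \<open>The potential and the choice of a multiplier\<close>

text \<open>Both \<open>log 2\<close> and \<open>multiplicity 2\<close> turn products into sums, so
  this closed form avoids prime factorizations; the correction lowers the value at 2 from
  \<open>A\<close> to 1.\<close>

definition potential :: "real \<Rightarrow> nat \<Rightarrow> real" where
  "potential A n = A * log 2 n - (A - 1) * multiplicity 2 n"

lemma potential_mult:
  assumes "m > 0" "n > 0"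
  shows "potential A (m * n) = potential A m + potential A n"
proof -
  have "multiplicity 2 (m * n) = multiplicity 2 m + multiplicity 2 n"
    using assms by (intro prime_elem_multiplicity_mult_distrib) auto
  then show ?thesis using assms
    by (simp add: potential_def log_mult algebra_simps)
qed

lemma potential_1 [simp]: "potential A (Suc 0) = 0"
  by (simp add: potential_def)

lemma potential_le_log: "1 \<le> A \<Longrightarrow> potential A n \<le> A * log 2 n"
  by (simp add: potential_def)

lemma potential_odd: "odd n \<Longrightarrow> potential A n = A * log 2 n"
  by (simp add: potential_def not_dvd_imp_multiplicity_0)

lemma potential_even_le:
  assumes "even n" "n > 0" "1 \<le> A"
  shows "potential A n \<le> A * log 2 n - (A - 1)"
proof -
  have "1 \<le> multiplicity 2 n"
    using assms by (intro multiplicity_geI) auto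
  then have "(A - 1) * 1 \<le> (A - 1) * multiplicity 2 n"
    using assms(3) by (intro mult_left_mono) auto
  then show ?thesis by (simp add: potential_def)
qed

lemma potential_2: "potential A 2 = 1"
  by (simp add: potential_def)

text \<open>Even residues are cheap because of the factor 2, and small odd residues because they are
  small. Hence the residues whose potential is not below that of \<open>p\<close> by 1 form a short run of odd
  numbers just below \<open>p\<close>.\<close>

lemma card_bad_residues:
  fixes p d :: nat
  assumes p: "prime p" and d: "d \<ge> 1" and A: "2 \<le> A" "25 / 48 * d \<le> A"
  shows "d * card {r \<in> {1..<p}. potential A r > potential A p - 1} < p - 1"
proof (cases "p = 2")
  case True
  \<comment> \<open>The only residue is 1, and its potential 0 is exactly 1 below that of 2.\<close>
  have "{r \<in> {1..<p}. potential A r > potential A p - 1} = {}"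
  proof -
    have "r = Suc 0" if "r \<in> {1..<p}" for r using that True by auto
    then show ?thesis using True potential_2 by fastforce
  qed
  then show ?thesis using True by simp
next
  case False
  with p have podd: "odd p" and p3: "p \<ge> 3"
    using prime_odd_nat[of p] prime_ge_2_nat[of p] by force+
  \<comment> \<open>The ceiling of (p - 1) / d: thus d m \<ge> p - 1, yet d (m - 1) \<le> p - 2,
    which makes the final bound strict.\<close>
  define m where "m = (p - 2) div d + 1"
  let ?B = "{r \<in> {1..<p}. potential A r > potential A p - 1}"
  have sub: "odd r \<and> p < r + 2 * m" if "r \<in> ?B" for r
  proof (rule ccontr)
    assume neg: "\<not> (odd r \<and> p < r + 2 * m)"
    have r: "0 < r" "r < p" and rb: "potential A r > potential A p - 1" using that by auto
    have lg: "log 2 r \<le> log 2 p" using r by simp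
    have pp: "potential A p = A * log 2 p" by (rule potential_odd[OF podd])
    show False
    proof (cases "even r")
      case True
      \<comment> \<open>The factor 2 saves A - 1, which is at least 1 because A \<ge> 2.\<close>
      have "potential A r \<le> A * log 2 r - (A - 1)" using True r A by (intro potential_even_le) auto
      also have "\<dots> \<le> A * log 2 p - 1" using mult_left_mono[OF lg, of A] A by linarith
      finally show False using rb pp by linarith
    next
      case odd: False
      with neg have rm: "real r + 2 * real m \<le> real p" by linarith
      have "p - 2 < d * m" unfolding m_def using d
        by (metis dividend_less_div_times mult.commute Suc_eq_plus1 add.commute mult_Suc_right
            less_le_trans order_refl zero_less_one)
      then have "p \<le> d * m + 1" using p3 by linarith
      then have dm: "real p \<le> real d * real m + 1" by (metis of_nat_1 of_nat_add of_nat_le_iff of_nat_mult)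
      \<comment> \<open>Origin of 25/48 = (25/36)(1/2)(3/2): the bound on ln 2, the restriction to
        odd residues, and p \<le> (3/2)(p - 1) for p \<ge> 3.\<close>
      have "ln 2 * (3 * real p) \<le> (25 / 36) * (3 * real p)"
        using ln2_le_25_over_36 by (intro mult_right_mono) auto
      also have "\<dots> \<le> (25 / 8) * (real p - 1)" using p3 by simp
      also have "\<dots> \<le> (25 / 8) * (real d * real m)" using dm by simp
      also have "\<dots> = (25 / 48 * d) * (6 * real m)" by simp
      also have "\<dots> \<le> A * (6 * real m)" using A(2) by (intro mult_right_mono) auto
      finally have "ln 2 * real p \<le> A * (2 * real m)" by (simp add: algebra_simps)
      then have 1: "ln 2 \<le> A * (2 * real m / real p)" using p3 by (simp add: field_simps)
      have "2 * real m / real p \<le> 1 - real r / real p"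
        using rm p3 by (simp add: field_simps)
      also have "\<dots> \<le> ln (real p / real r)"
        using ln_le_minus_one[of "real r / real p"] r ln_div[of "real r" "real p"] ln_div[of "real p" "real r"]
        by simp
      finally have "A * (2 * real m / real p) \<le> A * ln (real p / real r)"
        using A by (intro mult_left_mono) auto
      with 1 have "ln 2 \<le> A * (ln p - ln r)" using r by (simp add: ln_div)
      then have "1 \<le> A * (log 2 p - log 2 r)" by (simp add: log_def field_simps)
      then show False using rb pp potential_odd[OF odd, of A] by (simp add: algebra_simps)
    qed
  qed
  \<comment> \<open>Bad residues have positive even distance below 2m from \<open>p\<close>, so half
    the distance takes at most m - 1 values.\<close>
  have "card ?B \<le> card {1..<m}"
  proof (rule card_inj_on_le[where f = "\<lambda>r. (p - r) div 2"])
    show "inj_on (\<lambda>r. (p - r) div 2) ?B"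
    proof (rule inj_onI)
      fix r s assume rs: "r \<in> ?B" "s \<in> ?B" and eq: "(p - r) div 2 = (p - s) div 2"
      have "even (p - r)" "even (p - s)" using sub[OF rs(1)] sub[OF rs(2)] podd by auto
      then have "p - r = p - s" using eq by (metis dvd_mult_div_cancel)
      then show "r = s" using rs by auto
    qed
    show "(\<lambda>r. (p - r) div 2) ` ?B \<subseteq> {1..<m}"
    proof
      fix y assume "y \<in> (\<lambda>r. (p - r) div 2) ` ?B"
      then obtain r where r: "r \<in> ?B" "y = (p - r) div 2" by blast
      have "even (p - r)" using sub[OF r(1)] podd by auto
      then have "p - r = 2 * y" using r(2) by simp
      then show "y \<in> {1..<m}" using r(1) sub[OF r(1)] by auto
    qed
  qed simp
  then have "d * card ?B \<le> d * (m - 1)" by (simp add: mult_le_mono2)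
  also have "\<dots> \<le> p - 2" unfolding m_def by simp
  also have "\<dots> < p - 1" using p3 by simp
  finally show ?thesis .
qed

text \<open>Multiplication by \<open>z i\<close> is injective on nonzero residues, so each
  coordinate excludes at most as many \<open>j\<close> as there are bad residues. Coordinates
  divisible by \<open>p\<close> stay zero and impose nothing.\<close>

lemma exists_good_multiplier:
  fixes p :: nat and z :: "'n::finite \<Rightarrow> int"
  assumes p: "prime p" and A: "2 \<le> A" "25 / 48 * CARD('n) \<le> A"
  shows "\<exists>j::int. \<not> int p dvd j \<and> (\<forall>i. \<not> int p dvd z i \<longrightarrow>
    potential A (nat (j * z i mod int p)) \<le> potential A p - 1)"
proof -
  let ?B = "{r \<in> {1..<p}. potential A r > potential A p - 1}"
  let ?I = "{i. \<not> int p dvd z i}"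
  let ?r = "\<lambda>i j. nat (int j * z i mod int p)"
  define J where "J = (\<lambda>i. {j \<in> {1..<p}. ?r i j \<in> ?B})"
  have p0: "p > 0" using p prime_gt_0_nat by blast
  have pz: "prime (int p)" using p by simp
  have cJ: "card (J i) \<le> card ?B" if i: "i \<in> ?I" for i
  proof (rule card_inj_on_le[where f = "?r i"])
    show "inj_on (?r i) (J i)"
    proof (rule inj_onI)
      fix j k assume jk: "j \<in> J i" "k \<in> J i" and eq: "?r i j = ?r i k"
      have "int j * z i mod int p = int k * z i mod int p"
        using eq p0 by (metis eq_nat_nat_iff of_nat_0_less_iff pos_mod_sign)
      then have "int p dvd int j * z i - int k * z i" by (simp add: mod_eq_dvd_iff)
      then have "int p dvd (int j - int k) * z i" by (simp add: algebra_simps)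
      then have d: "int p dvd int j - int k" using i pz by (simp add: prime_dvd_mult_iff)
      have "j < p" "k < p" using jk by (auto simp: J_def)
      then have "int j mod int p = int j" "int k mod int p = int k" by auto
      then show "j = k" using d by (simp add: mod_eq_dvd_iff[symmetric])
    qed
  qed (auto simp: J_def)
  have "card (\<Union>i\<in>?I. J i) \<le> (\<Sum>i\<in>?I. card (J i))" by (rule card_UN_le) simp
  also have "\<dots> \<le> (\<Sum>i\<in>?I. card ?B)" by (intro sum_mono cJ)
  also have "\<dots> \<le> CARD('n) * card ?B"
    by (simp add: card_mono mult_le_mono1)
  also have "\<dots> < p - 1" using card_bad_residues[OF p _ A] by simp
  also have "p - 1 = card {1..<p}" by simp
  finally have "card (\<Union>i\<in>?I. J i) < card {1..<p}" .
  moreover have "finite (\<Union>i\<in>?I. J i)" by (simp add: J_def)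
  ultimately have "\<not> {1..<p} \<subseteq> (\<Union>i\<in>?I. J i)" using card_mono leD by blast
  then obtain j where j: "j \<in> {1..<p}" "j \<notin> (\<Union>i\<in>?I. J i)" by blast
  have jp: "\<not> int p dvd int j" using j(1) by (auto dest: dvd_imp_le)
  have "potential A (?r i j) \<le> potential A p - 1" if i: "\<not> int p dvd z i" for i
  proof -
    have "\<not> int p dvd int j * z i" using i jp pz by (simp add: prime_dvd_mult_iff)
    then have "int j * z i mod int p \<noteq> 0" by (simp add: dvd_eq_mod_eq_0)
    moreover have "0 \<le> int j * z i mod int p" "int j * z i mod int p < int p" using p0 by auto
    ultimately have "?r i j \<in> {1..<p}" by (auto simp: nat_less_iff)
    then show ?thesis using j i by (force simp: J_def)
  qed
  then show ?thesis using jp by blast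
qed

section \<open>Lattice families and their determinants\<close>

definition family_det :: "('n::finite \<Rightarrow> real ^ 'n) \<Rightarrow> real" where
  "family_det w = det (\<chi> i. w i)"

lemma family_det_nonzero_iff:
  fixes w :: "'n::finite \<Rightarrow> real ^ 'n"
  shows "family_det w \<noteq> 0 \<longleftrightarrow> (\<forall>c. (\<Sum>i\<in>UNIV. c i *\<^sub>R w i) = 0 \<longrightarrow> (\<forall>i. c i = 0))"
  using matrix_right_invertible_independent_rows[of "(\<chi> i. w i) :: real^'n^'n"]
    invertible_det_nz[of "(\<chi> i. w i) :: real^'n^'n"]
  by (simp add: family_det_def invertible_right_inverse row_def scalar_mult_eq_scaleR vec_lambda_eta)

lemma family_det_nonzeroI:
  assumes "inj w" "independent (range w)"
  shows "family_det w \<noteq> 0"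
  unfolding family_det_nonzero_iff
proof (intro allI impI)
  fix c i assume c: "(\<Sum>i\<in>UNIV. c i *\<^sub>R w i) = 0"
  have "(\<Sum>s\<in>range w. c (inv w s) *\<^sub>R s) = 0"
    by (subst sum.reindex[OF assms(1)]) (simp add: assms(1) c)
  from independentD[OF assms(2) _ subset_refl this, of "w i"] show "c i = 0"
    by (simp add: assms(1))
qed

lemma family_det_nonzeroD:
  assumes "family_det w \<noteq> 0"
  shows "inj w" "independent (range w)"
proof -
  show inj: "inj w"
  proof (rule injI, rule ccontr)
    fix i j assume ij: "w i = w j" "i \<noteq> j"
    have "(\<Sum>k\<in>UNIV. (if k = i then 1 else if k = j then -1 else 0) *\<^sub>R w k) =
      (\<Sum>k\<in>UNIV. (if k = i then w k else 0) + (if k = j then - w k else 0))"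
      by (rule sum.cong) (use ij in auto)
    also have "\<dots> = 0" using ij by (simp add: sum.distrib)
    finally show False
      using assms[unfolded family_det_nonzero_iff, rule_format,
        of "\<lambda>k. if k = i then 1 else if k = j then -1 else 0" i] by simp
  qed
  show "independent (range w)"
  proof (rule independent_if_scalars_zero)
    fix f x assume f: "(\<Sum>x\<in>range w. f x *\<^sub>R x) = 0" and x: "x \<in> range w"
    have "(\<Sum>i\<in>UNIV. f (w i) *\<^sub>R w i) = 0"
      using f by (subst (asm) sum.reindex[OF inj]) simp
    then show "f x = 0" using assms[unfolded family_det_nonzero_iff, rule_format, of "f \<circ> w"] x by auto
  qed simp
qed

lemma family_coordinates:
  fixes w :: "'n::finite \<Rightarrow> real ^ 'n"
  assumes "family_det w \<noteq> 0"
  obtains c where "y = (\<Sum>i\<in>UNIV. c i *\<^sub>R w i)"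
proof -
  let ?W = "(\<chi> i. w i) :: real^'n^'n"
  obtain B where B: "B ** ?W = mat 1"
    using assms invertible_det_nz[of ?W] unfolding family_det_def invertible_def by blast
  have "y = y v* (B ** ?W)" by (simp add: B vector_matrix_mul_rid)
  also have "\<dots> = (y v* B) v* ?W" by (simp add: vector_matrix_mul_assoc)
  also have "\<dots> = (\<Sum>i\<in>UNIV. (y v* B) $ i *\<^sub>R w i)"
    by (simp add: vec_eq_iff vector_matrix_mult_def mult.commute)
  finally show ?thesis using that by blast
qed

lemma family_coordinates_unique:
  assumes "family_det w \<noteq> 0" "(\<Sum>i\<in>UNIV. a i *\<^sub>R w i) = (\<Sum>i\<in>UNIV. b i *\<^sub>R w i)"
  shows "a i = b i"
proof -
  have "(\<Sum>i\<in>UNIV. (a i - b i) *\<^sub>R w i) = 0"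
    using assms(2) by (simp add: scaleR_diff_left sum_subtractf)
  then show ?thesis using assms(1)[unfolded family_det_nonzero_iff, rule_format, of "\<lambda>i. a i - b i"] by auto
qed

text \<open>Cramer's rule: it turns coordinates of a lattice point into ratios of
  multiplicities.\<close>

lemma family_det_upd:
  assumes "x = (\<Sum>i\<in>UNIV. c i *\<^sub>R w i)"
  shows "family_det (w(k := x)) = c k * family_det w"
proof -
  have "(\<chi> i. (w(k := x)) i) = (\<chi> i. if i = k then (\<Sum>i\<in>UNIV. (\<chi> i. c i) $ i *s row i (\<chi> i. w i))
      else row i (\<chi> i. w i))"
    by (simp add: vec_eq_iff row_def assms scalar_mult_eq_scaleR)
  then show ?thesis
    using cramer_lemma_transpose[of k "\<chi> i. c i" "\<chi> i. w i"] by (simp add: family_det_def)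
qed

section \<open>The integer lattice and the index of a sublattice\<close>

lemma int_lattice_add: "x \<in> int_lattice \<Longrightarrow> y \<in> int_lattice \<Longrightarrow> x + y \<in> int_lattice"
  and int_lattice_diff: "x \<in> int_lattice \<Longrightarrow> y \<in> int_lattice \<Longrightarrow> x - y \<in> int_lattice"
  and int_lattice_zero: "0 \<in> int_lattice"
  and int_lattice_scale: "x \<in> int_lattice \<Longrightarrow> of_int k *\<^sub>R x \<in> int_lattice"
  by (auto simp: int_lattice_def)

lemma int_lattice_sum: "(\<And>i. i \<in> I \<Longrightarrow> f i \<in> int_lattice) \<Longrightarrow> sum f I \<in> int_lattice"
  by (auto simp: int_lattice_def)

lemma sublatticeI: "x = (\<Sum>i\<in>UNIV. of_int (a i) *\<^sub>R w i) \<Longrightarrow> x \<in> sublattice w"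
  unfolding sublattice_def by blast

lemma sublattice_subset_int_lattice:
  assumes "range w \<subseteq> int_lattice"
  shows "sublattice w \<subseteq> int_lattice"
  using assms unfolding sublattice_def by (auto intro!: int_lattice_sum int_lattice_scale)

lemma family_det_Ints:
  assumes "range w \<subseteq> int_lattice"
  shows "family_det w \<in> \<int>"
proof -
  have "w i $ j \<in> \<int>" for i j using assms by (auto simp: int_lattice_def)
  then show ?thesis unfolding family_det_def det_def
    by (intro Ints_sum Ints_mult Ints_prod) auto
qed

text \<open>The determinant of a lattice family is an integer, so the floor loses nothing; it only
  makes the value a natural number, as \<open>potential\<close> and induction require.\<close>

definition family_index :: "('n::finite \<Rightarrow> real ^ 'n) \<Rightarrow> nat" where
  "family_index w = nat \<lfloor>\<bar>family_det w\<bar>\<rfloor>"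

lemma real_family_index:
  assumes "range w \<subseteq> int_lattice"
  shows "real (family_index w) = \<bar>family_det w\<bar>"
proof -
  have "\<bar>family_det w\<bar> \<in> \<int>" using family_det_Ints[OF assms] by simp
  then show ?thesis by (simp add: family_index_def of_nat_nat)
qed

lemma family_index_pos:
  "range w \<subseteq> int_lattice \<Longrightarrow> family_det w \<noteq> 0 \<Longrightarrow> family_index w > 0"
  using real_family_index[of w] by (metis abs_eq_0_iff of_nat_0 gr0I)

text \<open>By Cramer's rule each coordinate of \<open>y\<close> times the determinant is again a
  determinant of lattice vectors, hence an integer.\<close>

lemma index_scale_in_sublattice:
  assumes "range w \<subseteq> int_lattice" "family_det w \<noteq> 0" "y \<in> int_lattice"
  shows "real (family_index w) *\<^sub>R y \<in> sublattice w"
proof -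
  obtain c where c: "y = (\<Sum>i\<in>UNIV. c i *\<^sub>R w i)" using family_coordinates[OF assms(2)] .
  have "real (family_index w) * c i \<in> \<int>" for i
  proof -
    have "range (w(i := y)) \<subseteq> int_lattice" using assms(1,3) by auto
    then have "c i * family_det w \<in> \<int>"
      using family_det_Ints[of "w(i := y)"] family_det_upd[OF c, of i] by simp
    moreover have "- (c i * family_det w) \<in> \<int>" using calculation by simp
    ultimately show ?thesis
      unfolding real_family_index[OF assms(1)] abs_if by (auto simp: mult.commute)
  qed
  then have k: "real (family_index w) * c i = of_int \<lfloor>real (family_index w) * c i\<rfloor>" for i
    by simp
  have "real (family_index w) *\<^sub>R y = (\<Sum>i\<in>UNIV. of_int \<lfloor>real (family_index w) * c i\<rfloor> *\<^sub>R w i)"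
    unfolding c scaleR_sum_right scaleR_scaleR k[symmetric] ..
  then show ?thesis by (rule sublatticeI)
qed

lemma sublattice_eq_if_index_1:
  assumes "range w \<subseteq> int_lattice" "family_index w = 1"
  shows "sublattice w = int_lattice"
proof -
  have "family_det w \<noteq> 0" using assms(2) by (auto simp: family_index_def)
  from index_scale_in_sublattice[OF assms(1) this] have "int_lattice \<subseteq> sublattice w"
    unfolding assms(2) by auto
  then show ?thesis using sublattice_subset_int_lattice[OF assms(1)] by blast
qed

text \<open>Writing the unit vectors integrally in \<open>w\<close> inverts the matrix of
  \<open>w\<close> over the integers, and integers with product 1 are units.\<close>

lemma index_1_if_sublattice_eq:
  fixes w :: "'n::finite \<Rightarrow> real ^ 'n"
  assumes "range w \<subseteq> int_lattice" "int_lattice \<subseteq> sublattice w"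
  shows "family_index w = 1"
proof -
  have "\<exists>a :: 'n \<Rightarrow> int. axis k 1 = (\<Sum>i\<in>UNIV. of_int (a i) *\<^sub>R w i)" for k :: 'n
  proof -
    have "axis k 1 \<in> (int_lattice :: (real^'n) set)" by (simp add: int_lattice_def axis_def)
    then have "axis k 1 \<in> sublattice w" using assms(2) by blast
    then show ?thesis unfolding sublattice_def by simp
  qed
  then have "\<forall>k. \<exists>a :: 'n \<Rightarrow> int. axis k 1 = (\<Sum>i\<in>UNIV. of_int (a i) *\<^sub>R w i)" by blast
  from choice[OF this] obtain a :: "'n \<Rightarrow> 'n \<Rightarrow> int"
    where a: "\<And>k. axis k 1 = (\<Sum>i\<in>UNIV. of_int (a k i) *\<^sub>R w i)" by blast
  define A :: "real^'n^'n" where "A = (\<chi> k i. of_int (a k i))"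
  have "A ** (\<chi> i. w i) = mat 1"
  proof -
    have "(A ** (\<chi> i. w i)) $ k $ l = axis k 1 $ l" for k l
      unfolding a by (simp add: A_def matrix_matrix_mult_def)
    then show ?thesis by (auto simp: vec_eq_iff mat_def axis_def)
  qed
  then have AW: "det A * family_det w = 1"
    unfolding family_det_def by (metis det_I det_mul)
  have "det A \<in> \<int>" unfolding det_def A_def by (intro Ints_sum Ints_mult Ints_prod) auto
  then obtain m where m: "det A = of_int m" by (rule Ints_cases)
  obtain n where n: "family_det w = of_int n" using family_det_Ints[OF assms(1)] by (rule Ints_cases)
  have "m * n = 1" using AW m n by (metis of_int_1 of_int_eq_iff of_int_mult)
  then have "\<bar>n\<bar> = 1" by (metis abs_zmult_eq_1 mult.commute abs_1)
  then have "\<bar>family_det w\<bar> = 1" using n by (metis of_int_1 of_int_abs)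
  then show ?thesis by (simp add: family_index_def)
qed

text \<open>Cauchy's theorem for the quotient by the sublattice: a nonzero class has some finite
  order \<open>n\<close>, and its multiple by n / p has order \<open>p\<close>.\<close>

lemma exists_prime_order_class:
  fixes w :: "'n::finite \<Rightarrow> real ^ 'n"
  assumes w: "range w \<subseteq> int_lattice" "family_det w \<noteq> 0" and "family_index w \<noteq> 1"
  shows "\<exists>p z x. prime (p::nat) \<and> x \<in> int_lattice \<and>
    x = (\<Sum>i\<in>UNIV. (of_int (z i) / of_nat p) *\<^sub>R w i) \<and> (\<exists>i. \<not> int p dvd z i)"
proof -
  obtain y where y: "y \<in> int_lattice" "y \<notin> sublattice w"
    using index_1_if_sublattice_eq[OF w(1)] assms(3) by blast
  define n where "n = (LEAST n. n > 0 \<and> real n *\<^sub>R y \<in> sublattice w)"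
  have ex: "family_index w > 0 \<and> real (family_index w) *\<^sub>R y \<in> sublattice w"
    using index_scale_in_sublattice[OF w y(1)] family_index_pos[OF w] by blast
  have n: "n > 0" "real n *\<^sub>R y \<in> sublattice w"
    using LeastI[where P = "\<lambda>n. n > 0 \<and> real n *\<^sub>R y \<in> sublattice w", OF ex] by (auto simp: n_def)
  have least: "real k *\<^sub>R y \<notin> sublattice w" if "k > 0" "k < n" for k
    using not_less_Least[of k "\<lambda>n. n > 0 \<and> real n *\<^sub>R y \<in> sublattice w"] that by (auto simp: n_def)
  have "n \<noteq> 1" using n(2) y(2) by auto
  then obtain p where p: "prime p" "p dvd n" using prime_factor_nat by blast
  then obtain k where k: "n = p * k" by blast
  have k0: "k > 0" "k < n" using k n(1) prime_gt_1_nat[OF p(1)] by auto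
  obtain z :: "'n \<Rightarrow> int" where z: "real n *\<^sub>R y = (\<Sum>i\<in>UNIV. of_int (z i) *\<^sub>R w i)"
    using n(2) unfolding sublattice_def by blast
  define x where "x = real k *\<^sub>R y"
  have p0: "real p > 0" using prime_gt_0_nat[OF p(1)] by simp
  have "real p *\<^sub>R x = (\<Sum>i\<in>UNIV. of_int (z i) *\<^sub>R w i)" using z k by (simp add: x_def)
  then have "x = (1 / real p) *\<^sub>R (\<Sum>i\<in>UNIV. of_int (z i) *\<^sub>R w i)" using p0 
    by (metis nonzero_divide_eq_eq order_less_irrefl scaleR_one scaleR_scaleR)
  then have x: "x = (\<Sum>i\<in>UNIV. (of_int (z i) / of_nat p) *\<^sub>R w i)"
    by (simp add: scaleR_sum_right)
  have "\<exists>i. \<not> int p dvd z i"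
  proof (rule ccontr)
    assume "\<not> ?thesis"
    then have "\<forall>i. \<exists>q. z i = int p * q" unfolding dvd_def by blast
    from choice[OF this] obtain q where q: "\<And>i. z i = int p * q i" by blast
    have "x = (\<Sum>i\<in>UNIV. of_int (q i) *\<^sub>R w i)" unfolding x q using p0 by simp
    then have "x \<in> sublattice w" unfolding sublattice_def by blast
    then show False using least[OF k0] by (simp add: x_def)
  qed
  moreover have "x \<in> int_lattice"
    unfolding x_def using int_lattice_scale[OF y(1), of "int k"] by simp
  ultimately show ?thesis using p(1) x by blast
qed

section \<open>Fans\<close>

text \<open>The inclusion is the face condition stated on generators; its converse is monotonicity
  of \<open>pos_span\<close>. Rays may be non-primitive until the index is 1.\<close>

definition fan :: "('n::finite \<Rightarrow> real ^ 'n) set \<Rightarrow> bool" where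
  "fan K \<longleftrightarrow> finite K \<and> (\<forall>w\<in>K. family_det w \<noteq> 0 \<and> range w \<subseteq> int_lattice) \<and>
    (\<forall>w\<in>K. \<forall>w'\<in>K. pos_span (range w) \<inter> pos_span (range w') \<subseteq> pos_span (range w \<inter> range w'))"

definition support :: "('n::finite \<Rightarrow> real ^ 'n) set \<Rightarrow> (real ^ 'n) set" where
  "support K = (\<Union>w\<in>K. pos_span (range w))"

text \<open>\<open>U\<close> is meant as the ray set of the face whose relative interior contains
  \<open>x\<close>; only the star of this face is altered.\<close>

definition stellar :: "('n::finite \<Rightarrow> real ^ 'n) set \<Rightarrow> (real ^ 'n) set \<Rightarrow> real ^ 'n
    \<Rightarrow> ('n \<Rightarrow> real ^ 'n) set" where
  "stellar K U x = {w \<in> K. \<not> U \<subseteq> range w} \<union> {w(i := x) | w i. w \<in> K \<and> U \<subseteq> range w \<and> w i \<in> U}"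

lemma stellar_cases [consumes 1, case_names old new]:
  assumes "w' \<in> stellar K U x"
  obtains "w' \<in> K" "\<not> U \<subseteq> range w'"
  | w i where "w \<in> K" "U \<subseteq> range w" "w i \<in> U" "w' = w(i := x)"
  using assms unfolding stellar_def by blast

lemma range_fun_upd_inj: "inj w \<Longrightarrow> range (w(i := x)) = insert x (range w - {w i})"
  by (auto simp: inj_def image_iff)

lemma family_sum_extend:
  fixes w :: "'n::finite \<Rightarrow> 'a::real_vector"
  assumes "inj w" "U \<subseteq> range w"
  shows "(\<Sum>u\<in>U. c u *\<^sub>R u) = (\<Sum>i\<in>UNIV. (if w i \<in> U then c (w i) else 0) *\<^sub>R w i)"
proof -
  have "(\<Sum>u\<in>U. c u *\<^sub>R u) = (\<Sum>u\<in>range w. (if u \<in> U then c u else 0) *\<^sub>R u)"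
    by (rule sum.mono_neutral_cong_left) (use assms in auto)
  then show ?thesis by (simp add: sum.reindex[OF assms(1)])
qed

lemma family_det_stellar:
  assumes "family_det w \<noteq> 0" "U \<subseteq> range w" "w i \<in> U" "x = (\<Sum>u\<in>U. c u *\<^sub>R u)"
  shows "family_det (w(i := x)) = c (w i) * family_det w"
  using family_det_upd[OF assms(4)[unfolded family_sum_extend[OF family_det_nonzeroD(1)[OF assms(1)] assms(2)]], of i]
    assms(3) by simp

text \<open>A mixed pair works because the old cone lacks a ray of \<open>U\<close>; a pair of new
  cones because both parents contain \<open>U\<close> and give \<open>x\<close> the same
  coordinates.\<close>

lemma fan_stellar:
  assumes K: "fan K" and x: "x \<in> int_lattice" "x = (\<Sum>u\<in>U. c u *\<^sub>R u)" and c: "\<And>u. u \<in> U \<Longrightarrow> 0 < c u"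
  shows "fan (stellar K U x)"
proof -
  have finK: "finite K" and detK: "\<And>w. w \<in> K \<Longrightarrow> family_det w \<noteq> 0"
    and latK: "\<And>w. w \<in> K \<Longrightarrow> range w \<subseteq> int_lattice"
    and intK: "\<And>w w'. w \<in> K \<Longrightarrow> w' \<in> K \<Longrightarrow>
      pos_span (range w) \<inter> pos_span (range w') \<subseteq> pos_span (range w \<inter> range w')"
    using K unfolding fan_def by blast+
  note injK = family_det_nonzeroD(1)[OF detK] and indK = family_det_nonzeroD(2)[OF detK]
  have "stellar K U x \<subseteq> K \<union> (\<lambda>(w, i). w(i := x)) ` (K \<times> UNIV)"
    unfolding stellar_def by auto
  then have fin: "finite (stellar K U x)"
    by (rule finite_subset) (use finK in simp)
  have 1: "family_det w' \<noteq> 0 \<and> range w' \<subseteq> int_lattice" if "w' \<in> stellar K U x" for w'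
    using that
  proof (cases rule: stellar_cases)
    case old
    then show ?thesis using detK latK by blast
  next
    case (new w i)
    have "family_det w' \<noteq> 0"
      unfolding new(4) family_det_stellar[OF detK[OF new(1)] new(2,3) x(2)]
      using c[OF new(3)] detK[OF new(1)] by simp
    moreover have "range w' \<subseteq> int_lattice" using latK[OF new(1)] x(1) unfolding new(4) by auto
    ultimately show ?thesis by blast
  qed
  have 2: "pos_span (range w') \<inter> pos_span (range v') \<subseteq> pos_span (range w' \<inter> range v')"
    if w': "w' \<in> stellar K U x" and v': "v' \<in> stellar K U x" for w' v'
    using w'
  proof (cases rule: stellar_cases)
    case oldw: old
    show ?thesis using v'
    proof (cases rule: stellar_cases)
      case old
      then show ?thesis using oldw intK by blast
    next
      case (new v i)
      have "pos_span (range v') \<inter> pos_span (range w') \<subseteq> pos_span (range v' \<inter> range w')"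
        unfolding new(4) range_fun_upd_inj[OF injK[OF new(1)]]
        by (rule pos_span_stellar_Int_unchanged[OF _ indK[OF new(1)] _ intK[OF new(1) oldw(1)] new(2) oldw(2) c x(2) new(3)])
          auto
      then show ?thesis by (simp add: Int_commute)
    qed
  next
    case neww: (new w i)
    show ?thesis using v'
    proof (cases rule: stellar_cases)
      case old
      show ?thesis
        unfolding neww(4) range_fun_upd_inj[OF injK[OF neww(1)]]
        by (rule pos_span_stellar_Int_unchanged[OF _ indK[OF neww(1)] _ intK[OF neww(1) old(1)] neww(2) old(2) c x(2) neww(3)])
          auto
    next
      case (new v j)
      show ?thesis
        unfolding neww(4) new(4) range_fun_upd_inj[OF injK[OF neww(1)]] range_fun_upd_inj[OF injK[OF new(1)]]
        by (rule pos_span_stellar_Int[OF _ indK[OF neww(1)] _ indK[OF new(1)] intK[OF neww(1) new(1)]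
            neww(2) new(2) c x(2) neww(3) new(3)]) auto
    qed
  qed
  show ?thesis unfolding fan_def using fin 1 2 by blast
qed

lemma support_stellar:
  fixes K :: "('n::finite \<Rightarrow> real ^ 'n) set"
  assumes K: "fan K" and x: "x = (\<Sum>u\<in>U. c u *\<^sub>R u)" and c: "\<And>u. u \<in> U \<Longrightarrow> 0 < c u" and U: "U \<noteq> {}"
  shows "support (stellar K U x) = support K"
proof -
  have injK: "inj w" if "w \<in> K" for w
    using K that family_det_nonzeroD(1) unfolding fan_def by blast
  have star: "pos_span (range w) = (\<Union>i\<in>{i. w i \<in> U}. pos_span (range (w(i := x))))"
    if w: "w \<in> K" "U \<subseteq> range w" for w
  proof -
    have "(\<Union>u\<in>U. f u) = (\<Union>i\<in>{i. w i \<in> U}. f (w i))" for f :: "real ^ 'n \<Rightarrow> (real ^ 'n) set"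
      using w(2) by fastforce
    then show ?thesis
      unfolding range_fun_upd_inj[OF injK[OF w(1)]]
      using pos_span_stellar_Un[OF finite_imageI[OF finite] w(2) U c x] by simp
  qed
  show ?thesis
  proof (intro equalityI subsetI)
    fix y assume "y \<in> support (stellar K U x)"
    then obtain w' where w': "w' \<in> stellar K U x" "y \<in> pos_span (range w')" unfolding support_def by blast
    from w'(1) show "y \<in> support K"
    proof (cases rule: stellar_cases)
      case old
      then show ?thesis using w'(2) unfolding support_def by blast
    next
      case (new w i)
      then show ?thesis using w'(2) star[OF new(1,2)] unfolding support_def by blast
    qed
  next
    fix y assume "y \<in> support K"
    then obtain w where w: "w \<in> K" "y \<in> pos_span (range w)" unfolding support_def by blast
    show "y \<in> support (stellar K U x)"
    proof (cases "U \<subseteq> range w")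
      case True
      then obtain i where "w i \<in> U" "y \<in> pos_span (range (w(i := x)))" using star[OF w(1)] w(2) by blast
      then show ?thesis using True w(1) unfolding support_def stellar_def by blast
    next
      case False
      then show ?thesis using w unfolding support_def stellar_def by blast
    qed
  qed
qed

section \<open>One subdivision: the choice of the ray and its effect on index and heights\<close>

lemma exists_good_ray:
  fixes w :: "'n::finite \<Rightarrow> real ^ 'n"
  assumes w: "range w \<subseteq> int_lattice" "family_det w \<noteq> 0" "family_index w \<noteq> 1"
    and A: "2 \<le> A" "25 / 48 * CARD('n) \<le> A"
  obtains p :: nat and U r x where "prime p" "U \<subseteq> range w" "U \<noteq> {}" "x \<in> int_lattice"
    "x = (\<Sum>u\<in>U. (real (r u) / real p) *\<^sub>R u)"
    "\<forall>u\<in>U. 0 < r u \<and> r u < p \<and> potential A (r u) \<le> potential A p - 1"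
proof -
  obtain p :: nat and z x0 where pz: "prime p" "x0 \<in> int_lattice"
    "x0 = (\<Sum>i\<in>UNIV. (of_int (z i) / of_nat p) *\<^sub>R w i)" "\<exists>i. \<not> int p dvd z i"
    using exists_prime_order_class[OF w] by blast
  obtain j where j: "\<not> int p dvd j" "\<And>i. \<not> int p dvd z i \<Longrightarrow>
    potential A (nat (j * z i mod int p)) \<le> potential A p - 1"
    using exists_good_multiplier[OF pz(1) A, of z] by blast
  have inj: "inj w" by (rule family_det_nonzeroD(1)[OF w(2)])
  have p0: "p > 0" using prime_gt_0_nat[OF pz(1)] .
  define s where "s = (\<lambda>i. nat (j * z i mod int p))"
  \<comment> \<open>Keeping only nonzero residues makes all coefficients of \<open>x\<close>
    positive, as stellar subdivision requires.\<close>
  define U where "U = w ` {i. \<not> int p dvd z i}"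
  define r where "r = (\<lambda>u. s (inv w u))"
  have s_int: "int (s i) = j * z i mod int p" for i using p0 by (simp add: s_def)
  have s_less: "s i < p" for i using p0 by (simp add: s_def nat_less_iff)
  have s_pos: "0 < s i \<longleftrightarrow> \<not> int p dvd z i" for i
  proof -
    have "s i = 0 \<longleftrightarrow> j * z i mod int p = 0" using s_int[of i] by (metis of_nat_eq_0_iff)
    also have "\<dots> \<longleftrightarrow> int p dvd j * z i" by (simp add: dvd_eq_mod_eq_0)
    also have "\<dots> \<longleftrightarrow> int p dvd z i" using j(1) pz(1) by (simp add: prime_dvd_mult_iff)
    finally show ?thesis by auto
  qed
  define x where "x = (\<Sum>i\<in>UNIV. (real (s i) / real p) *\<^sub>R w i)"
  \<comment> \<open>Passing to residues subtracts an integer combination of the \<open>w i\<close>,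
    so \<open>x\<close> stays in the lattice.\<close>
  have coeff: "real (s i) / real p = of_int j * (of_int (z i) / of_nat p) - of_int (j * z i div int p)" for i
  proof -
    have "j * z i = (j * z i div int p) * int p + int (s i)" by (simp add: s_int)
    then have "real_of_int j * real_of_int (z i) = of_int (j * z i div int p) * real p + real (s i)"
      by (metis of_int_add of_int_mult of_int_of_nat_eq)
    then show ?thesis using p0 by (simp add: field_simps)
  qed
  have "x = of_int j *\<^sub>R x0 - (\<Sum>i\<in>UNIV. of_int (j * z i div int p) *\<^sub>R w i)"
    unfolding x_def coeff pz(3) scaleR_diff_left sum_subtractf scaleR_sum_right scaleR_scaleR ..
  moreover have "w i \<in> int_lattice" for i using w(1) by auto
  ultimately have "x \<in> int_lattice"
    by (auto intro!: int_lattice_diff int_lattice_sum int_lattice_scale pz(2))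
  moreover have "x = (\<Sum>u\<in>U. (real (r u) / real p) *\<^sub>R u)"
  proof -
    have "(\<Sum>u\<in>U. (real (r u) / real p) *\<^sub>R u) = (\<Sum>i\<in>{i. \<not> int p dvd z i}. (real (s i) / real p) *\<^sub>R w i)"
      unfolding U_def by (subst sum.reindex) (use inj in \<open>auto simp: r_def inj_on_def\<close>)
    also have "\<dots> = x"
      unfolding x_def by (rule sum.mono_neutral_left) (use s_pos in auto)
    finally show ?thesis by simp
  qed
  moreover have "0 < r u \<and> r u < p \<and> potential A (r u) \<le> potential A p - 1" if u: "u \<in> U" for u
  proof -
    obtain i where i: "u = w i" "\<not> int p dvd z i" using u unfolding U_def by blast
    have "r u = s i" using inj i(1) by (simp add: r_def)
    then show ?thesis using s_pos s_less j(2)[OF i(2)] i(2) by (simp add: s_def)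
  qed
  moreover have "U \<noteq> {}" "U \<subseteq> range w" using pz(4) by (auto simp: U_def)
  ultimately show thesis using that pz(1) by blast
qed

text \<open>\<open>w\<close> is any cone through \<open>U\<close>, not just the one for which
  \<open>x\<close> was chosen; of \<open>x\<close>, only its coefficients over \<open>U\<close>
  enter.\<close>

lemma stellar_family_bounds:
  fixes w :: "'n::finite \<Rightarrow> real ^ 'n"
  assumes w: "range w \<subseteq> int_lattice" "family_det w \<noteq> 0"
    and U: "U \<subseteq> range w" "w i \<in> U" and p: "p > 0"
    and x: "x \<in> int_lattice" "x = (\<Sum>u\<in>U. (real (r u) / real p) *\<^sub>R u)"
    and r: "\<forall>u\<in>U. 0 < r u \<and> r u < p \<and> potential A (r u) \<le> potential A p - 1"
    and h: "linear h" "\<And>i. 0 \<le> h (w i)"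
  shows "family_index (w(i := x)) < family_index w"
    and "(\<Sum>k\<in>UNIV. h ((w(i := x)) k)) * 2 powr potential A (family_index (w(i := x)))
      \<le> (\<Sum>k\<in>UNIV. h (w k)) * 2 powr potential A (family_index w)"
proof -
  note ri = r[rule_format, OF U(2)]
  let ?w = "w(i := x)"
  let ?T = "\<Sum>k\<in>UNIV. h (w k)"
  have lat: "range ?w \<subseteq> int_lattice" using w(1) x(1) by auto
  have det: "family_det ?w = real (r (w i)) / real p * family_det w"
    by (rule family_det_stellar[OF w(2) U x(2)])
  have "real (family_index ?w) * real p = real (r (w i)) * real (family_index w)"
    unfolding real_family_index[OF lat] real_family_index[OF w(1)] det using p by (simp add: abs_mult)
  \<comment> \<open>An equation in naturals without division, so that additivity of the potential
    applies to both sides.\<close>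
  then have eq: "family_index ?w * p = r (w i) * family_index w"
    by (metis of_nat_eq_iff of_nat_mult)
  have pos: "family_index w > 0" using family_index_pos[OF w] .
  have det_ne: "family_det ?w \<noteq> 0" using det ri p w(2) by simp
  have pos': "family_index ?w > 0" using family_index_pos[OF lat det_ne] .
  have "family_index ?w * p < family_index w * p" using eq ri pos by simp
  then show "family_index ?w < family_index w" by simp
  have "potential A (family_index ?w) + potential A p = potential A (r (w i)) + potential A (family_index w)"
    using arg_cong[OF eq, of "potential A"] pos pos' p ri by (simp add: potential_mult)
  then have "potential A (family_index ?w) + 1 \<le> potential A (family_index w)" using ri by linarith
  then have "2 powr (potential A (family_index ?w) + 1) \<le> 2 powr potential A (family_index w)" by simp
  then have pot: "2 * 2 powr potential A (family_index ?w) \<le> 2 powr potential A (family_index w)"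
    by (simp add: powr_add)
  have inj: "inj w" by (rule family_det_nonzeroD(1)[OF w(2)])
  \<comment> \<open>Coefficients below 1 make \<open>x\<close> no higher than all rays together. So
    the height sum at most doubles, which the halved power of 2 compensates.\<close>
  have "h x = (\<Sum>u\<in>U. (real (r u) / real p) * h u)"
    unfolding x(2) by (simp add: linear_sum[OF h(1)] linear_scale[OF h(1)])
  also have "\<dots> \<le> (\<Sum>u\<in>U. h u)"
  proof (rule sum_mono)
    fix u assume u: "u \<in> U"
    have "0 \<le> h u" using u U(1) h(2) by auto
    moreover have "real (r u) / real p \<le> 1" using r u by fastforce
    ultimately show "real (r u) / real p * h u \<le> h u" using mult_right_mono[of "real (r u) / real p" 1 "h u"] by simp
  qed
  also have "\<dots> \<le> (\<Sum>u\<in>range w. h u)"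
    by (rule sum_mono2) (use U(1) h(2) in auto)
  also have "\<dots> = ?T" by (simp add: sum.reindex[OF inj])
  finally have hx: "h x \<le> ?T" .
  have "(\<Sum>k\<in>UNIV. h (?w k)) = h x + (\<Sum>k\<in>UNIV - {i}. h (w k))"
    by (subst sum.remove[of _ i]) auto
  also have "(\<Sum>k\<in>UNIV - {i}. h (w k)) = ?T - h (w i)"
    by (subst (2) sum.remove[of _ i]) auto
  finally have "(\<Sum>k\<in>UNIV. h (?w k)) \<le> 2 * ?T" using hx h(2)[of i] by simp
  then have "(\<Sum>k\<in>UNIV. h (?w k)) * 2 powr potential A (family_index ?w)
      \<le> 2 * ?T * 2 powr potential A (family_index ?w)" by (intro mult_right_mono) auto
  also have "\<dots> = ?T * (2 * 2 powr potential A (family_index ?w))" by simp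
  also have "\<dots> \<le> ?T * 2 powr potential A (family_index w)"
    using pot h(2) by (intro mult_left_mono sum_nonneg) auto
  finally show "(\<Sum>k\<in>UNIV. h (?w k)) * 2 powr potential A (family_index ?w)
      \<le> ?T * 2 powr potential A (family_index w)" .
qed

section \<open>Termination and repeated subdivision\<close>

lemma sum_UN_le_nat:
  fixes f :: "'a \<Rightarrow> nat"
  assumes "finite I" "\<And>i. i \<in> I \<Longrightarrow> finite (X i)"
  shows "sum f (\<Union>i\<in>I. X i) \<le> (\<Sum>i\<in>I. sum f (X i))"
  using assms
proof (induction I rule: finite_induct)
  case (insert i I)
  have "sum f (X i \<union> (\<Union>i\<in>I. X i)) \<le> sum f (X i) + sum f (\<Union>i\<in>I. X i)"
    using insert by (subst sum_Un_nat) auto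
  with insert show ?case by fastforce
qed simp

text \<open>A subdivided cone gives way to at most d cones of smaller index, and d (d + 1)^k < (d +
  1)^(k + 1). Hence the total falls even when many cones are subdivided at once.\<close>

definition fan_weight :: "('n::finite \<Rightarrow> real ^ 'n) set \<Rightarrow> nat" where
  "fan_weight K = (\<Sum>w\<in>K. (CARD('n) + 1) ^ family_index w)"

lemma fan_weight_stellar_less:
  fixes K :: "('n::finite \<Rightarrow> real ^ 'n) set"
  assumes K: "finite K" and w0: "w0 \<in> K" "U \<subseteq> range w0"
    and less: "\<And>w i. w \<in> K \<Longrightarrow> U \<subseteq> range w \<Longrightarrow> w i \<in> U \<Longrightarrow> family_index (w(i := x)) < family_index w"
  shows "fan_weight (stellar K U x) < fan_weight K"
proof -
  let ?d = "CARD('n)"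
  let ?f = "\<lambda>w :: 'n \<Rightarrow> real ^ 'n. (?d + 1) ^ family_index w"
  let ?K0 = "{w \<in> K. \<not> U \<subseteq> range w}"
  let ?K1 = "{w \<in> K. U \<subseteq> range w}"
  let ?N = "\<lambda>w. (\<lambda>i. w(i := x)) ` {i. w i \<in> U}"
  have eq: "stellar K U x = ?K0 \<union> (\<Union>w\<in>?K1. ?N w)" unfolding stellar_def by blast
  have small: "(\<Sum>w'\<in>?N w. ?f w') < ?f w" if w: "w \<in> ?K1" for w
  proof (cases "{i. w i \<in> U} = {}")
    case True
    then have e: "?N w = {}" by simp
    show ?thesis unfolding e by simp
  next
    case False
    then obtain i0 where i0: "w i0 \<in> U" by blast
    obtain k where k: "family_index w = Suc k" using less[of w i0] w i0 by (cases "family_index w") auto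
    have "(\<Sum>w'\<in>?N w. ?f w') \<le> (\<Sum>w'\<in>?N w. (?d + 1) ^ k)"
    proof (rule sum_mono)
      fix w' assume "w' \<in> ?N w"
      then have "family_index w' \<le> k" using less[of w] w k by force
      then show "?f w' \<le> (?d + 1) ^ k" by (intro power_increasing) auto
    qed
    also have "\<dots> = card (?N w) * (?d + 1) ^ k" by simp
    also have "\<dots> \<le> ?d * (?d + 1) ^ k"
      by (intro mult_right_mono order_trans[OF card_image_le] card_mono) auto
    also have "\<dots> < ?f w" unfolding k by simp
    finally show ?thesis .
  qed
  have fin: "finite ?K0" "finite ?K1" using K by auto
  have "fan_weight (stellar K U x) \<le> sum ?f ?K0 + sum ?f (\<Union>w\<in>?K1. ?N w)"
    unfolding fan_weight_def eq using fin by (subst sum_Un_nat) auto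
  also have "sum ?f (\<Union>w\<in>?K1. ?N w) \<le> (\<Sum>w\<in>?K1. \<Sum>w'\<in>?N w. ?f w')"
    using fin by (intro sum_UN_le_nat) auto
  also have "(\<Sum>w\<in>?K1. \<Sum>w'\<in>?N w. ?f w') < (\<Sum>w\<in>?K1. ?f w)"
    using fin(2) small w0 by (intro sum_strict_mono) auto
  also have "sum ?f ?K0 + (\<Sum>w\<in>?K1. ?f w) = fan_weight K"
    unfolding fan_weight_def by (subst sum.union_disjoint[symmetric]) (use fin in \<open>auto intro!: sum.cong\<close>)
  finally show ?thesis by simp
qed

text \<open>The bound by \<open>B\<close> survives each subdivision; at index 1 the potential is 0,
  so \<open>B\<close> then bounds the sum of heights itself.\<close>

lemma fan_refinement:
  fixes K :: "('n::finite \<Rightarrow> real ^ 'n) set"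
  assumes K: "fan K"
    and A: "2 \<le> A" "25 / 48 * CARD('n) \<le> A"
    and h: "linear h" "\<And>y. y \<in> support K \<Longrightarrow> 0 \<le> h y"
    and B: "\<And>w. w \<in> K \<Longrightarrow> (\<Sum>i\<in>UNIV. h (w i)) * 2 powr potential A (family_index w) \<le> B"
  shows "\<exists>K'. fan K' \<and> support K' = support K \<and>
    (\<forall>w\<in>K'. family_index w = 1 \<and> (\<Sum>i\<in>UNIV. h (w i)) \<le> B)"
  using K h(2) B
proof (induction "fan_weight K" arbitrary: K rule: less_induct)
  case less
  show ?case
  proof (cases "\<forall>w\<in>K. family_index w = 1")
    case True
    have "(\<Sum>i\<in>UNIV. h (w i)) \<le> B" if "w \<in> K" for w
      using less.prems(3)[OF that] True that by simp
    then show ?thesis using less.prems(1) True by (intro exI[of _ K]) simp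
  next
    case False
    then obtain w0 where w0: "w0 \<in> K" "family_index w0 \<noteq> 1" by blast
    have lat: "range w \<subseteq> int_lattice" and det: "family_det w \<noteq> 0" if "w \<in> K" for w
      using less.prems(1) that unfolding fan_def by blast+
    obtain p :: nat and U r x where pU: "prime p" "U \<subseteq> range w0" "U \<noteq> {}" "x \<in> int_lattice"
      "x = (\<Sum>u\<in>U. (real (r u) / real p) *\<^sub>R u)"
      "\<forall>u\<in>U. 0 < r u \<and> r u < p \<and> potential A (r u) \<le> potential A p - 1"
      using exists_good_ray[OF lat[OF w0(1)] det[OF w0(1)] w0(2) A] .
    have p0: "p > 0" using prime_gt_0_nat[OF pU(1)] .
    have c: "0 < real (r u) / real p" if "u \<in> U" for u using pU(6) that p0 by simp
    have hw: "0 \<le> h (w i)" if "w \<in> K" for w i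
    proof -
      have "w i \<in> pos_span {w i}" by (rule pos_spanI[where a = "\<lambda>_. 1"]) auto
      then have "w i \<in> pos_span (range w)" using pos_span_mono[of "{w i}" "range w"] by auto
      then show ?thesis using less.prems(2) that unfolding support_def by blast
    qed
    have bounds: "family_index (w(i := x)) < family_index w"
      "(\<Sum>k\<in>UNIV. h ((w(i := x)) k)) * 2 powr potential A (family_index (w(i := x)))
        \<le> (\<Sum>k\<in>UNIV. h (w k)) * 2 powr potential A (family_index w)"
      if "w \<in> K" "U \<subseteq> range w" "w i \<in> U" for w i
      by (rule stellar_family_bounds[OF lat[OF that(1)] det[OF that(1)] that(2,3) p0 pU(4,5,6) h(1) hw[OF that(1)]])+
    have fan': "fan (stellar K U x)" by (rule fan_stellar[OF less.prems(1) pU(4,5) c])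
    have supp: "support (stellar K U x) = support K"
      by (rule support_stellar[OF less.prems(1) pU(5) c pU(3)])
    have "fan_weight (stellar K U x) < fan_weight K"
      by (rule fan_weight_stellar_less[OF _ w0(1) pU(2) bounds(1)])
        (use less.prems(1) in \<open>auto simp: fan_def\<close>)
    moreover have "(\<Sum>i\<in>UNIV. h (w' i)) * 2 powr potential A (family_index w') \<le> B"
      if "w' \<in> stellar K U x" for w'
      using that
    proof (cases rule: stellar_cases)
      case old
      then show ?thesis using less.prems(3) by blast
    next
      case (new w i)
      show ?thesis unfolding new(4)
        by (rule order_trans[OF bounds(2)[OF new(1,2,3)] less.prems(3)[OF new(1)]])
    qed
    ultimately have "\<exists>K'. fan K' \<and> support K' = support (stellar K U x) \<and>
      (\<forall>w\<in>K'. family_index w = 1 \<and> (\<Sum>i\<in>UNIV. h (w i)) \<le> B)"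
      using less.hyps[OF _ fan'] less.prems(2) supp by simp
    then show ?thesis using supp by simp
  qed
qed

section \<open>Multiplicities and Hilbert bases\<close>

lemma sublattice_diff:
  assumes "x \<in> sublattice w" "y \<in> sublattice w"
  shows "x - y \<in> sublattice w"
proof -
  obtain a where a: "x = (\<Sum>i\<in>UNIV. of_int (a i) *\<^sub>R w i)" using assms(1) unfolding sublattice_def by blast
  obtain b where b: "y = (\<Sum>i\<in>UNIV. of_int (b i) *\<^sub>R w i)" using assms(2) unfolding sublattice_def by blast
  show ?thesis unfolding a b
    by (intro sublatticeI[of _ "\<lambda>i. a i - b i"]) (simp add: scaleR_diff_left sum_subtractf)
qed

lemma sublattice_zero: "0 \<in> sublattice w"
  by (rule sublatticeI[of _ "\<lambda>_. 0"]) simp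

text \<open>Multiplying by an inverse of \<open>z i\<close> modulo \<open>p\<close> and correcting
  by a multiple of \<open>w i\<close> makes one coordinate exactly 1 / p. Exchanging
  \<open>w i\<close> for \<open>x\<close> then divides the index by \<open>p\<close> and enlarges
  the sublattice, which suits an induction on cosets.\<close>

lemma exists_index_prime_refinement:
  fixes w :: "'n::finite \<Rightarrow> real ^ 'n"
  assumes w: "range w \<subseteq> int_lattice" "family_det w \<noteq> 0" "family_index w \<noteq> 1"
  obtains p :: nat and i s x where "prime p" "x \<in> int_lattice" "s i = 1"
    "x = (\<Sum>k\<in>UNIV. (of_int (s k) / of_nat p) *\<^sub>R w k)"
proof -
  obtain p z x0 i where pz: "prime (p::nat)" "x0 \<in> int_lattice"
    "x0 = (\<Sum>i\<in>UNIV. (of_int (z i) / of_nat p) *\<^sub>R w i)" "\<not> int p dvd z i"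
    using exists_prime_order_class[OF w] by blast
  have "prime (int p)" using pz(1) by simp
  then have "coprime (int p) (z i)" using pz(4) by (rule prime_imp_coprime)
  then have "gcd (z i) (int p) = 1" by (simp add: gcd.commute)
  then obtain j q where jq: "j * z i + q * int p = 1"
    using bezout_int[of "z i" "int p"] by auto
  have p0: "real p > 0" using prime_gt_0_nat[OF pz(1)] by simp
  define s where "s = (\<lambda>k. if k = i then 1 else j * z k)"
  define x where "x = of_int j *\<^sub>R x0 + of_int q *\<^sub>R w i"
  have "w i \<in> int_lattice" using w(1) by blast
  then have "x \<in> int_lattice"
    unfolding x_def by (intro int_lattice_add int_lattice_scale pz(2))
  moreover have "s i = 1" by (simp add: s_def)
  moreover have "x = (\<Sum>k\<in>UNIV. (of_int (s k) / of_nat p) *\<^sub>R w k)"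
  proof -
    have c: "of_int (s k) / real p = of_int j * (of_int (z k) / real p) + (if k = i then of_int q else 0)" for k
    proof (cases "k = i")
      case True
      have "real_of_int j * of_int (z i) + of_int q * real p = 1"
        using arg_cong[OF jq, of real_of_int] by simp
      then show ?thesis using True p0 by (simp add: s_def field_simps)
    qed (simp add: s_def)
    have "(\<Sum>k\<in>UNIV. (if k = i then of_int q else 0) *\<^sub>R w k) = (\<Sum>k\<in>UNIV. if k = i then of_int q *\<^sub>R w k else 0)"
      by (intro sum.cong) auto
    then show ?thesis
      unfolding c scaleR_add_left sum.distrib x_def pz(3) by (simp add: scaleR_sum_right)
  qed
  ultimately show thesis using that pz(1) by blast
qed

text \<open>Since \<open>s i = 1\<close>, the old ray is recovered integrally: w_i is p x minus the
  sum of s_k w_k over k \<noteq> i.\<close>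

lemma sublattice_refine:
  fixes w :: "'n::finite \<Rightarrow> real ^ 'n"
  assumes p: "p > 0" and s: "s i = 1" and x: "x = (\<Sum>k\<in>UNIV. (of_int (s k) / of_nat p) *\<^sub>R w k)"
  shows "sublattice w \<subseteq> sublattice (w(i := x))"
proof
  fix y assume "y \<in> sublattice w"
  then obtain a where a: "y = (\<Sum>k\<in>UNIV. of_int (a k) *\<^sub>R w k)" unfolding sublattice_def by blast
  define b where "b = (\<lambda>k. if k = i then a i * int p else a k - a i * s k)"
  have px: "of_int (a i * int p) *\<^sub>R x = (\<Sum>k\<in>UNIV. of_int (a i * s k) *\<^sub>R w k)"
    unfolding x scaleR_sum_right using p by (intro sum.cong) auto
  have "(\<Sum>k\<in>UNIV. of_int (b k) *\<^sub>R (w(i := x)) k) =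
      of_int (a i * int p) *\<^sub>R x + (\<Sum>k\<in>UNIV - {i}. of_int (a k - a i * s k) *\<^sub>R w k)"
    by (subst sum.remove[of _ i]) (auto simp: b_def)
  also have "(\<Sum>k\<in>UNIV - {i}. of_int (a k - a i * s k) *\<^sub>R w k) =
      (\<Sum>k\<in>UNIV. of_int (a k - a i * s k) *\<^sub>R w k)"
    by (rule sum.mono_neutral_left) (auto simp: s)
  also have "of_int (a i * int p) *\<^sub>R x + \<dots> = y"
    unfolding px a by (simp add: scaleR_diff_left sum_subtractf)
  finally show "y \<in> sublattice (w(i := x))" by (rule sublatticeI[OF sym])
qed

text \<open>A lower bound for the number of cosets by a tower of prime steps: each class modulo the
  enlarged lattice yields \<open>p\<close> classes modulo the old one, told apart by multiples of
  \<open>x\<close>.\<close>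

lemma exists_incongruent_set:
  fixes w :: "'n::finite \<Rightarrow> real ^ 'n"
  assumes "range w \<subseteq> int_lattice" "family_det w \<noteq> 0"
  shows "\<exists>R. finite R \<and> R \<subseteq> int_lattice \<and> card R = family_index w \<and>
    (\<forall>x\<in>R. \<forall>y\<in>R. x - y \<in> sublattice w \<longrightarrow> x = y)"
  using assms
proof (induction "family_index w" arbitrary: w rule: less_induct)
  case less
  show ?case
  proof (cases "family_index w = 1")
    case True
    then show ?thesis using int_lattice_zero by (intro exI[of _ "{0}"]) auto
  next
    case False
    obtain p :: nat and i s x where ps: "prime p" "x \<in> int_lattice" "s i = 1"
      and x: "x = (\<Sum>k\<in>UNIV. (of_int (s k) / of_nat p) *\<^sub>R w k)"
      by (rule exists_index_prime_refinement[OF less.prems False]) (rule that)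
    have p0: "p > 0" and p1: "p > 1" using prime_gt_1_nat[OF ps(1)] by auto
    let ?w = "w(i := x)"
    have lat: "range ?w \<subseteq> int_lattice" using less.prems(1) ps(2) by auto
    have det: "family_det ?w = (1 / real p) * family_det w"
      using family_det_upd[OF x, of i] ps(3) by simp
    then have det': "family_det ?w \<noteq> 0" using less.prems(2) p0 by simp
    have "real (family_index w) = real p * real (family_index ?w)"
      unfolding real_family_index[OF lat] real_family_index[OF less.prems(1)] det using p0 by (simp add: abs_mult)
    then have idx: "family_index w = p * family_index ?w" by (metis of_nat_eq_iff of_nat_mult)
    then have "family_index ?w < family_index w"
      using family_index_pos[OF lat det'] p1 by simp
    from less.hyps[OF this lat det'] obtain R where R: "finite R" "R \<subseteq> int_lattice"
      "card R = family_index ?w" "\<And>y z. y \<in> R \<Longrightarrow> z \<in> R \<Longrightarrow> y - z \<in> sublattice ?w \<Longrightarrow> y = z" by blast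
    define f where "f = (\<lambda>(y, k :: nat). y + of_int (int k) *\<^sub>R x)"
    have incongruent: "y = z \<and> k = l"
      if yz: "y \<in> R" "z \<in> R" and kl: "k < p" "l < p" and d: "f (y, k) - f (z, l) \<in> sublattice w" for y z k l
    proof -
      have e: "f (y, k) - f (z, l) = (y - z) + of_int (int k - int l) *\<^sub>R x"
        by (simp add: f_def scaleR_diff_left)
      have "(\<Sum>m\<in>UNIV. of_int (if m = i then int k - int l else 0) *\<^sub>R ?w m) = of_int (int k - int l) *\<^sub>R x"
        by (subst sum.remove[of _ i]) auto
      then have "of_int (int k - int l) *\<^sub>R x \<in> sublattice ?w"
        by (intro sublatticeI[of _ "\<lambda>m. if m = i then int k - int l else 0"]) (rule sym)
      moreover have "f (y, k) - f (z, l) \<in> sublattice ?w"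
        using d sublattice_refine[OF p0 ps(3) x] by blast
      ultimately have "y - z \<in> sublattice ?w" using sublattice_diff e by fastforce
      then have yz': "y = z" using R(4) yz by blast
      then have "of_int (int k - int l) *\<^sub>R x \<in> sublattice w" using d e by simp
      then obtain a :: "'n \<Rightarrow> int" where a: "of_int (int k - int l) *\<^sub>R x = (\<Sum>m\<in>UNIV. of_int (a m) *\<^sub>R w m)"
        unfolding sublattice_def by blast
      \<comment> \<open>The coordinate of (k - l) x at \<open>i\<close> is (k - l) / p; it must be
        an integer, while |k - l| < p.\<close>
      have "(\<Sum>m\<in>UNIV. (of_int (int k - int l) * (of_int (s m) / real p)) *\<^sub>R w m) = (\<Sum>m\<in>UNIV. of_int (a m) *\<^sub>R w m)"
        unfolding a[symmetric] x by (simp add: scaleR_sum_right)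
      from family_coordinates_unique[OF less.prems(2) this, of i]
      have "real_of_int (int k - int l) = of_int (a i) * real p" using ps(3) p0 by (simp add: field_simps)
      then have "real_of_int (int k - int l) = real_of_int (a i * int p)" by simp
      then have kl': "int k - int l = a i * int p" by (simp only: of_int_eq_iff)
      have "\<bar>a i * int p\<bar> < int p" using kl' kl by linarith
      then have "a i = 0" using p0 by (simp add: abs_mult) 
      then show ?thesis using kl' yz' by simp
    qed
    have inj: "inj_on f (R \<times> {..<p})"
    proof (rule inj_onI)
      fix a b assume ab: "a \<in> R \<times> {..<p}" "b \<in> R \<times> {..<p}" "f a = f b"
      obtain y k z l where "a = (y, k)" "b = (z, l)" by (metis surj_pair)
      then show "a = b" using incongruent[of y z k l] ab sublattice_zero[of w] by auto
    qed
    have "card (f ` (R \<times> {..<p})) = family_index w"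
      unfolding card_image[OF inj] idx by (simp add: R(3) card_cartesian_product)
    moreover have "f ` (R \<times> {..<p}) \<subseteq> int_lattice"
      using R(2) ps(2) by (auto simp: f_def simp del: of_int_of_nat_eq intro!: int_lattice_add int_lattice_scale)
    moreover have "\<forall>a\<in>f ` (R \<times> {..<p}). \<forall>b\<in>f ` (R \<times> {..<p}). a - b \<in> sublattice w \<longrightarrow> a = b"
      using incongruent by fastforce
    ultimately show ?thesis using R(1) by (intro exI[of _ "f ` (R \<times> {..<p})"]) simp
  qed
qed

text \<open>This direction of the equality between determinant and coset count carries the length
  bound, which grows with the multiplicity.\<close>

lemma family_index_le_multiplicity:
  fixes w :: "'n::finite \<Rightarrow> real ^ 'n"
  assumes w: "range w \<subseteq> int_lattice" "family_det w \<noteq> 0" and pos: "multiplicity_of w > 0"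
  shows "family_index w \<le> multiplicity_of w"
proof -
  let ?r = "{(x, y). x \<in> int_lattice \<and> y \<in> int_lattice \<and> x - y \<in> sublattice w}"
  obtain R where R: "finite R" "R \<subseteq> int_lattice" "card R = family_index w"
    "\<And>x y. x \<in> R \<Longrightarrow> y \<in> R \<Longrightarrow> x - y \<in> sublattice w \<Longrightarrow> x = y"
    using exists_incongruent_set[OF w] by blast
  \<comment> \<open>\<open>card\<close> of an infinite set is 0, so a positive multiplicity makes
    the quotient finite.\<close>
  have fin: "finite (int_lattice // ?r)" using pos unfolding multiplicity_of_def by (rule card_ge_0_finite)
  have "card R \<le> card (int_lattice // ?r)"
  proof (rule card_inj_on_le[OF _ _ fin])
    show "inj_on (\<lambda>x. ?r `` {x}) R"
    proof (rule inj_onI)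
      fix x y assume xy: "x \<in> R" "y \<in> R" "?r `` {x} = ?r `` {y}"
      have "y \<in> ?r `` {y}" using xy(2) R(2) sublattice_zero by auto
      then have "y \<in> ?r `` {x}" using xy(3) by simp
      then show "x = y" using R(4) xy by simp
    qed
    show "(\<lambda>x. ?r `` {x}) ` R \<subseteq> int_lattice // ?r" using R(2) by (intro image_subsetI quotientI) blast
  qed
  then show ?thesis unfolding R(3) multiplicity_of_def .
qed

lemma multiplicity_1_if_index_1:
  assumes "range w \<subseteq> int_lattice" "family_index w = 1"
  shows "multiplicity_of w = 1"
proof -
  have "int_lattice // {(x, y). x \<in> int_lattice \<and> y \<in> int_lattice \<and> x - y \<in> sublattice w} = {int_lattice}"
    unfolding sublattice_eq_if_index_1[OF assms] quotient_def
    using int_lattice_zero by (auto intro: int_lattice_diff)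
  then show ?thesis by (simp add: multiplicity_of_def)
qed

section \<open>Unimodular families and their Hilbert bases\<close>

lemma index_1_det_nonzero: "family_index w = 1 \<Longrightarrow> family_det w \<noteq> 0"
  by (auto simp: family_index_def)

text \<open>Subdivision does not enforce primitivity; at index 1 it follows, because
  \<open>y\<close> has integer coordinates a_j and k a_i = 1.\<close>

lemma simplicial_generators_if_index_1:
  assumes w: "range w \<subseteq> int_lattice" "family_index w = 1"
  shows "simplicial_generators w"
proof -
  note det = index_1_det_nonzero[OF w(2)]
  note indep = family_det_nonzeroD[OF det]
  have "primitive (w i)" for i
    unfolding primitive_def
  proof (intro conjI allI ballI impI)
    show "w i \<in> int_lattice" using w(1) by blast
    show "w i \<noteq> 0" using indep(2) by (metis dependent_zero rangeI)
    fix k :: nat and y assume y: "y \<in> int_lattice" "w i = of_nat k *\<^sub>R y"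
    then have "y \<in> sublattice w" using sublattice_eq_if_index_1[OF w] by simp
    then obtain a :: "'a \<Rightarrow> int" where a: "y = (\<Sum>j\<in>UNIV. of_int (a j) *\<^sub>R w j)" unfolding sublattice_def by blast
    have "(\<Sum>j\<in>UNIV. of_int (int k * a j) *\<^sub>R w j) = (\<Sum>j\<in>UNIV. (if j = i then 1 else 0) *\<^sub>R w j)"
    proof -
      have "(\<Sum>j\<in>UNIV. of_int (int k * a j) *\<^sub>R w j) = w i"
        unfolding y(2) a by (simp add: scaleR_sum_right)
      also have "\<dots> = (\<Sum>j\<in>UNIV. if j = i then w j else 0)" by simp
      also have "\<dots> = (\<Sum>j\<in>UNIV. (if j = i then 1 else 0) *\<^sub>R w j)" by (intro sum.cong) auto
      finally show ?thesis .
    qed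
    from family_coordinates_unique[OF det this, of i] have "real_of_int (int k * a i) = 1" by simp
    then have "int k * a i = 1" by linarith
    then show "k = 1" by (metis abs_of_nat abs_zmult_eq_1 abs_1 of_nat_eq_1_iff)
  qed
  then show ?thesis unfolding simplicial_generators_def using indep by blast
qed

lemma add_submonoid_sum:
  assumes "add_submonoid M" "\<And>i. i \<in> I \<Longrightarrow> f i \<in> M"
  shows "sum f I \<in> M"
  using assms(2)
  by (induction I rule: infinite_finite_induct) (use assms(1) in \<open>auto simp: add_submonoid_def\<close>)

lemma add_submonoid_of_nat_scale:
  fixes x :: "'a::real_vector"
  assumes "add_submonoid M" "x \<in> M"
  shows "real n *\<^sub>R x \<in> M"
  by (induction n) (use assms in \<open>auto simp: add_submonoid_def scaleR_add_left\<close>)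

text \<open>The lattice points of the cone form the free commutative monoid on
  \<open>range w\<close>. Its free generators are irreducible and lie in every generating set, so
  the minimal one is unique and \<open>THE\<close> is well defined.\<close>

lemma Hilb_unimodular:
  fixes w :: "'n::finite \<Rightarrow> real ^ 'n"
  assumes w: "range w \<subseteq> int_lattice" "family_index w = 1"
  shows "Hilb (cone_of w) = range w"
proof -
  note det = index_1_det_nonzero[OF w(2)]
  let ?M = "cone_of w \<inter> int_lattice"
  define s where "s = (\<lambda>n :: 'n \<Rightarrow> nat. \<Sum>i\<in>UNIV. real (n i) *\<^sub>R w i)"
  have M: "?M = range s"
  proof (intro equalityI subsetI)
    fix x assume x: "x \<in> ?M"
    then obtain b where b: "\<forall>i. 0 \<le> b i" "x = (\<Sum>i\<in>UNIV. b i *\<^sub>R w i)" unfolding cone_of_def by blast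
    have "x \<in> sublattice w" using x sublattice_eq_if_index_1[OF w] by simp
    then obtain a :: "'n \<Rightarrow> int" where a: "x = (\<Sum>i\<in>UNIV. of_int (a i) *\<^sub>R w i)" unfolding sublattice_def by blast
    have "of_int (a i) = b i" for i using family_coordinates_unique[OF det, of "\<lambda>i. of_int (a i)" b i] a b(2) by simp
    then have "0 \<le> a i" for i using b(1) by (metis of_int_0_le_iff)
    then have "x = s (\<lambda>i. nat (a i))" unfolding a s_def by simp
    then show "x \<in> range s" by simp
  next
    fix x assume "x \<in> range s"
    then obtain n where n: "x = s n" by blast
    have "x \<in> cone_of w" unfolding n s_def cone_of_def by (rule CollectI, rule exI[of _ "\<lambda>i. real (n i)"]) simp
    moreover have "x \<in> sublattice w" unfolding n s_def by (rule sublatticeI[of _ "\<lambda>i. int (n i)"]) simp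
    ultimately show "x \<in> ?M" using sublattice_eq_if_index_1[OF w] by simp
  qed
  have add: "s m + s n = s (\<lambda>i. m i + n i)" for m n by (simp add: s_def scaleR_add_left sum.distrib)
  have uniq: "m = n" if "s m = s n" for m n
    using family_coordinates_unique[OF det that[unfolded s_def]] by (simp add: fun_eq_iff)
  have s0: "s (\<lambda>_. 0) = 0" by (simp add: s_def)
  have wi: "w i = s (\<lambda>j. if j = i then 1 else 0)" for i
  proof -
    have "s (\<lambda>j. if j = i then 1 else 0) = (\<Sum>j\<in>UNIV. if j = i then w j else 0)" unfolding s_def by (intro sum.cong) auto
    then show ?thesis by simp
  qed
  have subM: "add_submonoid ?M"
    unfolding M add_submonoid_def
  proof (intro conjI ballI)
    show "0 \<in> range s" using rangeI[of s "\<lambda>_. 0"] unfolding s0 .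
  qed (auto simp: add)
  have wM: "range w \<subseteq> ?M" unfolding M by (auto simp: wi)
  have gen: "add_submonoid hull (range w) = ?M"
  proof (rule hull_unique)
    show "range w \<subseteq> ?M" by (rule wM)
    show "add_submonoid ?M" by (rule subM)
    fix N assume N: "range w \<subseteq> N" "add_submonoid N"
    then show "?M \<subseteq> N" unfolding M s_def
      by (auto intro!: add_submonoid_sum add_submonoid_of_nat_scale)
  qed
  have irred: "range w \<subseteq> G" if G: "add_submonoid hull G = ?M" for G
  proof (rule ccontr)
    assume "\<not> range w \<subseteq> G"
    then obtain i where i: "w i \<notin> G" by blast
    \<comment> \<open>Irreducibility of \<open>w i\<close> makes the complement a submonoid; it
      contains any \<open>G\<close> that avoids \<open>w i\<close>, so such a \<open>G\<close>
      cannot generate.\<close>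
    have "add_submonoid (?M - {w i})"
      unfolding add_submonoid_def
    proof (intro conjI ballI)
      show "0 \<in> ?M - {w i}"
        using subM simplicial_generators_if_index_1[OF w]
        unfolding add_submonoid_def simplicial_generators_def primitive_def by force
      fix x y assume xy: "x \<in> ?M - {w i}" "y \<in> ?M - {w i}"
      then obtain m n where mn: "x = s m" "y = s n" unfolding M by blast
      have "x + y \<noteq> w i"
      proof
        assume "x + y = w i"
        then have "s (\<lambda>j. m j + n j) = s (\<lambda>j. if j = i then 1 else 0)" using mn add wi by simp
        from fun_cong[OF uniq[OF this]] have e: "m j + n j = (if j = i then 1 else 0)" for j .
        have z: "m j = 0 \<and> n j = 0" if "j \<noteq> i" for j using e[of j] that by simp
        have "m i + n i = 1" using e[of i] by simp
        then consider "m i = 1" "n i = 0" | "m i = 0" "n i = 1" by linarith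
        then show False
        proof cases
          case 1
          then have "m = (\<lambda>j. if j = i then 1 else 0)" using z by auto
          then show False using xy(1) mn(1) wi by simp
        next
          case 2
          then have "n = (\<lambda>j. if j = i then 1 else 0)" using z by auto
          then show False using xy(2) mn(2) wi by simp
        qed
      qed
      then show "x + y \<in> ?M - {w i}" using xy subM unfolding add_submonoid_def by blast
    qed
    moreover have "G \<subseteq> ?M - {w i}" using i hull_subset[of G add_submonoid] G by blast
    ultimately have "?M \<subseteq> ?M - {w i}" using hull_minimal[of G "?M - {w i}" add_submonoid] G by simp
    then show False using wM by blast
  qed
  have iff: "minimal_generating_set ?M G \<longleftrightarrow> G = range w" for G
  proof
    assume G: "minimal_generating_set ?M G"
    then have "range w \<subseteq> G" using irred unfolding minimal_generating_set_def by blast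
    then show "G = range w" using G gen unfolding minimal_generating_set_def by blast
  next
    assume "G = range w"
    then show "minimal_generating_set ?M G"
      unfolding minimal_generating_set_def using gen irred by blast
  qed
  show ?thesis unfolding Hilb_def by (rule the_equality) (simp_all only: iff)
qed

section \<open>The length bound\<close>

text \<open>The comparison 2^79 \<le> 3^50, divided by 2^50.\<close>

lemma log2_three_halves_ge: "29 / 50 \<le> log 2 (3 / 2 :: real)"
proof -
  have "log 2 (2 ^ 29 :: real) \<le> log 2 ((3 / 2) ^ 50)" by (subst log_le_cancel_iff) (simp_all add: power_divide)
  moreover have "log 2 (2 ^ 29 :: real) = 29" "log 2 ((3 / 2 :: real) ^ 50) = 50 * log 2 (3 / 2)"
    by (subst log_nat_power; simp)+
  ultimately show ?thesis by linarith
qed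

text \<open>25/48 is what the residue count demands per dimension; 0.29 * 1.25506 * 1.44 is about
  0.524, just above 0.521.\<close>

lemma gam_ge: "25 / 48 \<le> gam"
proof -
  have ln2: "0 < ln (2 :: real)" "ln (2 :: real) \<le> 25 / 36" using ln2_le_25_over_36 by auto
  then have "36 / 25 \<le> log 2 (exp 1 :: real)" by (simp add: log_def field_simps)
  moreover have rt: "29 / 100 * 1.25506 \<le> rho * tau"
    using log2_three_halves_ge by (simp add: rho_def tau_def)
  moreover have "0 \<le> rho * tau" by (rule order_trans[OF _ rt]) simp
  ultimately have "29 / 100 * 1.25506 * (36 / 25) \<le> rho * tau * log 2 (exp 1)"
    by (intro mult_mono[of "29 / 100 * 1.25506" "rho * tau" "36 / 25"]) (assumption | simp)+
  then show ?thesis by (simp add: gam_def)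
qed

lemma kappa_ge: "87 / 100 \<le> kappa"
  using log2_three_halves_ge by (simp add: kappa_def eps_def)

text \<open>Lowering the exponent by 3/2 pays for the factor 1/4: (3/2) log2 m \<ge> 2 once log2 m
  \<ge> 4/3, which holds from m = 3 on since 2^4 \<le> 3^3. For m \<le> 2 the potential is at most
  1, and M \<ge> 2 with E \<ge> 7/2 suffices.\<close>

lemma length_bound:
  fixes m M d :: nat and E :: real
  assumes "0 < m" "m \<le> M" "1 < M" "7 / 2 \<le> E"
  shows "real d * 2 powr potential (E - 3 / 2) m \<le> real d / 4 * real M powr E"
proof -
  have logM: "1 \<le> log 2 (real M)" using assms(3) by simp
  have EM: "E \<le> E * log 2 (real M)" using mult_left_mono[OF logM, of E] assms(4) by simp
  have key: "potential (E - 3 / 2) m + 2 \<le> E * log 2 (real M)"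
  proof -
    consider "m = 1" | "m = 2" | "m \<ge> 3" using assms(1) by linarith
    then show ?thesis
    proof cases
      case 1
      then have "potential (E - 3 / 2) m = 0" by simp
      then show ?thesis using EM assms(4) by linarith
    next
      case 2
      then have "potential (E - 3 / 2) m = 1" using potential_2 by simp
      then show ?thesis using EM assms(4) by linarith
    next
      case 3
      have "log 2 (2 ^ 4 :: real) \<le> log 2 (3 ^ 3)" by (subst log_le_cancel_iff) simp_all
      moreover have "log 2 (2 ^ 4 :: real) = 4" "log 2 (3 ^ 3 :: real) = 3 * log 2 3"
        by (subst log_nat_power; simp)+
      ultimately have "4 / 3 \<le> log 2 (3 :: real)" by linarith
      also have "log 2 3 \<le> log 2 (real m)" using 3 by simp
      finally have lm: "4 / 3 \<le> log 2 (real m)" .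
      have "potential (E - 3 / 2) m + 2 \<le> (E - 3 / 2) * log 2 (real m) + 2"
        using potential_le_log[of "E - 3 / 2" m] assms(4) by simp
      also have "\<dots> \<le> E * log 2 (real m)" using lm by (simp add: algebra_simps)
      also have "\<dots> \<le> E * log 2 (real M)"
        using assms 3 by (intro mult_left_mono) auto
      finally show ?thesis .
    qed
  qed
  have "2 powr potential (E - 3 / 2) m * 4 = 2 powr (potential (E - 3 / 2) m + 2)"
    by (simp add: powr_add)
  also have "\<dots> \<le> 2 powr (E * log 2 (real M))" using key by simp
  also have "\<dots> = (2 powr log 2 (real M)) powr E" by (simp add: powr_powr mult.commute)
  also have "\<dots> = real M powr E" using assms(3) by simp
  finally have "real d * (2 powr potential (E - 3 / 2) m * 4) \<le> real d * real M powr E"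
    by (rule mult_left_mono) simp
  then show ?thesis by simp
qed

section \<open>Assembling the triangulation and the length bound\<close>

lemma mem_scaled_basic_simplex:
  fixes v :: "'n::finite \<Rightarrow> real ^ 'n"
  assumes v: "inj v" "independent (range v)" and h: "linear h" "\<And>i. h (v i) = 1"
    and y: "y \<in> cone_of v" "h y \<le> c" and c: "0 < c"
  shows "y \<in> (\<lambda>y. c *\<^sub>R y) ` basic_simplex v"
proof -
  obtain a where a: "\<forall>i. 0 \<le> a i" "y = (\<Sum>i\<in>UNIV. a i *\<^sub>R v i)" using y(1) unfolding cone_of_def by blast
  \<comment> \<open>\<open>h\<close> adds up the coordinates, so h y \<le> c places y / c in the
    basic simplex.\<close>
  have "h y = (\<Sum>i\<in>UNIV. a i)"
    unfolding a(2) by (simp add: linear_sum[OF h(1)] linear_scale[OF h(1)] h(2))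
  then have sum_a: "(\<Sum>i\<in>UNIV. a i / c) \<le> 1" using y(2) c by (simp add: sum_divide_distrib[symmetric])
  let ?u = "\<lambda>x. a (inv v x) / c"
  have "0 \<notin> range v" using v(2) dependent_zero by blast
  moreover have "sum ?u (range v) \<le> 1" "(\<Sum>x\<in>range v. ?u x *\<^sub>R x) = (1 / c) *\<^sub>R y"
    using sum_a by (simp_all add: sum.reindex[OF v(1)] v(1) a(2) scaleR_sum_right)
  moreover have "\<forall>x\<in>range v. 0 \<le> ?u x" using a(1) c by simp
  ultimately have "(1 / c) *\<^sub>R y \<in> basic_simplex v"
    unfolding basic_simplex_def by (subst Starlike.simplex) auto
  then show ?thesis using c by (intro image_eqI[of _ _ "(1 / c) *\<^sub>R y"]) simp_all
qed

lemma unimodular_triangulation_of_fan: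
  assumes K: "fan K" and index: "\<And>w. w \<in> K \<Longrightarrow> family_index w = 1"
  shows "unimodular_triangulation (support K) (cone_of ` K)"
proof -
  have gen: "simplicial_generators w" "multiplicity_of w = 1" if "w \<in> K" for w
    using K index[OF that] that simplicial_generators_if_index_1 multiplicity_1_if_index_1
    unfolding fan_def by blast+
  have inj: "inj w" and indep: "independent (range w)" if "w \<in> K" for w
    using gen(1)[OF that] unfolding simplicial_generators_def by blast+
  have cone: "cone_of w = pos_span (range w)" if "w \<in> K" for w
    by (rule cone_of_eq_pos_span[OF inj[OF that]])
  have face: "cone_of w \<inter> cone_of w' face_of cone_of w" if w: "w \<in> K" "w' \<in> K" for w w'
  proof -
    have "pos_span (range w) \<inter> pos_span (range w') \<subseteq> pos_span (range w \<inter> range w')"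
      using K w unfolding fan_def by blast
    moreover have "pos_span (range w \<inter> range w') \<subseteq> pos_span (range w) \<inter> pos_span (range w')"
      by (intro Int_greatest pos_span_mono) auto
    ultimately have "pos_span (range w) \<inter> pos_span (range w') = pos_span (range w \<inter> range w')" by blast
    then show ?thesis
      unfolding cone[OF w(1)] cone[OF w(2)]
      using pos_span_face_of[OF indep[OF w(1)], of "range w \<inter> range w'"] by simp
  qed
  then have face': "cone_of w \<inter> cone_of w' face_of cone_of w'" if w: "w \<in> K" "w' \<in> K" for w w'
    using face[OF w(2,1)] by (simp add: Int_commute)
  have "finite K" using K unfolding fan_def by blast
  moreover have "\<Union> (cone_of ` K) = support K" unfolding support_def using cone by simp
  moreover have "simplicial_cone (cone_of w)" "unimodular_cone (cone_of w)" if "w \<in> K" for w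
    unfolding simplicial_cone_def unimodular_cone_def using gen[OF that] by auto
  ultimately show ?thesis
    unfolding unimodular_triangulation_def triangulation_def using face face' by simp
qed

theorem corollary5p3:
  fixes v :: "'n::finite \<Rightarrow> real ^ 'n"
  assumes "CARD('n) \<ge> 2"
    and "simplicial_generators v"
    and "multiplicity_of v > 1"
  shows "\<exists>T. unimodular_triangulation (cone_of v) T \<and>
    (\<forall>D\<in>T. Hilb D \<subseteq>
      (\<lambda>y. (real CARD('n) / 4 *
             real (multiplicity_of v) powr
               (gam * real CARD('n) + 2 * log 2 (real CARD('n)) + kappa)) *\<^sub>R y)
        ` basic_simplex v)"
proof -
  let ?d = "real CARD('n)"
  define E where "E = gam * ?d + 2 * log 2 ?d + kappa"
  define c where "c = ?d / 4 * real (multiplicity_of v) powr E"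
  have inj: "inj v" and indep: "independent (range v)" and lat: "range v \<subseteq> int_lattice"
    using assms(2) unfolding simplicial_generators_def primitive_def by blast+
  have det: "family_det v \<noteq> 0" by (rule family_det_nonzeroI[OF inj indep])
  have "1 \<le> log 2 ?d" using assms(1) by simp
  moreover have "25 / 48 * ?d \<le> gam * ?d" using gam_ge by (intro mult_right_mono) auto
  moreover have "2 \<le> ?d" using assms(1) by simp
  \<comment> \<open>For d \<ge> 2, 25/24 + 2 + 87/100 exceeds 7/2 and 2 log2 d + kappa exceeds 3/2,
    so A = E - 3/2 is large enough for the residue count.\<close>
  ultimately have E: "7 / 2 \<le> E" "25 / 48 * ?d \<le> E - 3 / 2"
    using kappa_ge unfolding E_def by linarith+
  have c0: "0 < c" using assms(3) by (simp add: c_def)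
  \<comment> \<open>The height: the linear form equal to 1 on the facet of the basic simplex
    opposite to 0.\<close>
  obtain h where h: "linear h" "\<And>i. h (v i) = (1 :: real)"
    using linear_independent_extend[OF indep, of "\<lambda>_. 1"] by auto
  have supp: "support {v} = cone_of v" by (simp add: support_def cone_of_eq_pos_span[OF inj])
  have "fan {v}" unfolding fan_def using det lat by simp
  moreover have "0 \<le> h y" if y: "y \<in> support {v}" for y
  proof -
    obtain a where "\<forall>i. 0 \<le> a i" "y = (\<Sum>i\<in>UNIV. a i *\<^sub>R v i)"
      using y unfolding supp cone_of_def by blast
    then show ?thesis by (simp add: linear_sum[OF h(1)] linear_scale[OF h(1)] h(2) sum_nonneg)
  qed
  moreover have "(\<Sum>i\<in>UNIV. h (w i)) * 2 powr potential (E - 3 / 2) (family_index w) \<le> c" if "w \<in> {v}" for w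
    using length_bound[of "family_index v" "multiplicity_of v" E "CARD('n)"] that E(1) assms(3)
      family_index_pos[OF lat det] family_index_le_multiplicity[OF lat det] by (simp add: h(2) c_def)
  ultimately obtain K where K: "fan K" "support K = support {v}"
    "\<And>w. w \<in> K \<Longrightarrow> family_index w = 1" "\<And>w. w \<in> K \<Longrightarrow> (\<Sum>i\<in>UNIV. h (w i)) \<le> c"
    using fan_refinement[of "{v}" "E - 3 / 2" h c] h(1) E by auto
  have "Hilb (cone_of w) \<subseteq> (\<lambda>y. c *\<^sub>R y) ` basic_simplex v" if w: "w \<in> K" for w
  proof -
    have wlat: "range w \<subseteq> int_lattice" and wdet: "family_det w \<noteq> 0" using K(1) w unfolding fan_def by blast+
    have wC: "w i \<in> cone_of v" for i
    proof -
      have "w i \<in> pos_span {w i}" by (rule pos_spanI[where a = "\<lambda>_. 1"]) auto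
      then have "w i \<in> pos_span (range w)" using pos_span_mono[of "{w i}" "range w"] by auto
      then show ?thesis using w K(2) unfolding supp[symmetric] support_def by blast
    qed
    have h0: "0 \<le> h (w i)" for i
    proof -
      obtain a where "\<forall>i. 0 \<le> a i" "w i = (\<Sum>i\<in>UNIV. a i *\<^sub>R v i)"
        using wC[of i] unfolding cone_of_def by blast
      then show ?thesis by (simp add: linear_sum[OF h(1)] linear_scale[OF h(1)] h(2) sum_nonneg)
    qed
    \<comment> \<open>Heights are nonnegative in the cone, so the bound on their sum bounds each of
      them.\<close>
    have "h (w i) \<le> c" for i
      using member_le_sum[of i UNIV "\<lambda>i. h (w i)"] h0 K(4)[OF w] by fastforce
    then show ?thesis
      unfolding Hilb_unimodular[OF wlat K(3)[OF w]]
      using mem_scaled_basic_simplex[OF inj indep h wC _ c0] by blast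
  qed
  moreover have "unimodular_triangulation (cone_of v) (cone_of ` K)"
    using unimodular_triangulation_of_fan[OF K(1,3)] K(2) supp by simp
  ultimately show ?thesis unfolding c_def E_def by blast
qed

end
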